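(* Assume the uniform $abc$-conjecture over number fields. Let $E/\mathbb{Q}$ be an elliptic curve given by a Weierstrass equation with integer coefficients. Then for every $\epsilon>0$ there exists a constant $c_\epsilon$ (depending on $E$ and $\epsilon$) such that \[ \max\left\{\tfrac{1}{2}\log |a_P|,\ \log |d_P|\right\}\le(1+\epsilon) \log \operatorname{rad} (d_P) + c_\epsilon \] for all $P\in E(\mathbb{Q})\setminus\{O\}$.
   Context: $O$ denotes the point at infinity of $E$. Every $P\in E(\mathbb{Q})\setminus\{O\}$ can be written as $P=\left(\frac{a_P}{d_P^2},\frac{b_P}{d_P^3}\right)$ with $a_P,b_P,d_P\in\mathbb{Z}$, $d_P\ge 1$, and $\gcd(d_P,a_Pb_P)=1$. For a nonzero integer $n$, $\operatorname{rad}(n)$ is the product of the distinct primes dividing $n$. The uniform $abc$-conjecture over number fields is the statement: for every $\epsilon>0$ and every integer $d\ge1$ there is a constant $C_{\epsilon,d}$ such that for every number field $K$ with $[K:\mathbb{Q}]\le d$ and all $a,b,c\in K^\times$ with $a+b+c=0$, one has $h(a:b:c)\le(1+\epsilon)\big(\log\operatorname{rad}_K(a,b,c)+\log|\operatorname{disc}(K)|\big)+C_{\epsilon,d}$, where $h$ is the absolute logarithmic height on $\mathbb{P}^2$ and $\log\operatorname{rad}_K(a,b,c)=\frac{1}{[K:\mathbb{Q}]}\sum_{\mathfrak p}\log N(\mathfrak p)$, the sum over the finite primes $\mathfrak p$ of $K$ at which $v_{\mathfrak p}(a),v_{\mathfrak p}(b),v_{\mathfrak p}(c)$ are not all equal.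 *)

theory Defs
  imports
    Complex_Main
    "HOL-Algebra.Embedded_Algebras"
    "HOL-Algebra.Ideal_Product"
    "HOL-Algebra.QuotRing"
    "Jordan_Normal_Form.Determinant"
begin

section \<open>Number fields\<close>

definition complex_ring :: "complex ring" where
  "complex_ring = \<lparr>carrier = UNIV, monoid.mult = (*), one = 1, ring.zero = 0, add = (+)\<rparr>"

text \<open>Every number field is isomorphic to a subfield of the complex numbers of finite degree
  over the rationals; number fields are represented by such subfields.\<close>

definition number_field :: "complex set \<Rightarrow> bool" where
  "number_field K \<longleftrightarrow> subfield K complex_ring \<and> ring.finite_dimension complex_ring \<rat> K"

definition nf_degree :: "complex set \<Rightarrow> nat" where
  "nf_degree K = (ring.dim complex_ring over \<rat>) K"

text \<open>Embeddings are normalised to be \<^const>\<open>undefined\<close> outside \<open>K\<close>, so that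
  there are exactly \<open>nf_degree K\<close> of them.\<close>

definition nf_embeddings :: "complex set \<Rightarrow> (complex \<Rightarrow> complex) set" where
  "nf_embeddings K = Ring.ring_hom (complex_ring\<lparr>carrier := K\<rparr>) complex_ring \<inter> extensional K"

definition ring_of_integers :: "complex set \<Rightarrow> complex ring" where
  "ring_of_integers K = complex_ring\<lparr>carrier := {x \<in> K. algebraic_int x}\<rparr>"

definition integral_basis :: "complex set \<Rightarrow> complex list \<Rightarrow> bool" where
  "integral_basis K \<omega> \<longleftrightarrow>
     set \<omega> \<subseteq> carrier (ring_of_integers K) \<and>
     (\<forall>x \<in> carrier (ring_of_integers K).
        \<exists>!c :: int list. length c = length \<omega> \<and> x = (\<Sum>i<length \<omega>. of_int (c ! i) * \<omega> ! i))"

definition nf_disc :: "complex set \<Rightarrow> int" where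
  "nf_disc K = (THE D. \<exists>\<sigma> \<omega>.
     distinct \<sigma> \<and> set \<sigma> = nf_embeddings K \<and> integral_basis K \<omega> \<and>
     of_int D = (det (mat (nf_degree K) (nf_degree K) (\<lambda>(i, j). (\<sigma> ! i) (\<omega> ! j))))\<^sup>2)"

definition finite_primes :: "complex set \<Rightarrow> complex set set" where
  "finite_primes K = {\<pp>. primeideal \<pp> (ring_of_integers K) \<and> \<pp> \<noteq> {0}}"

definition prime_norm :: "complex set \<Rightarrow> complex set \<Rightarrow> nat" where
  "prime_norm K \<pp> = card (carrier (ring_of_integers K Quot \<pp>))"

definition integral_valuation :: "complex set \<Rightarrow> complex set \<Rightarrow> complex \<Rightarrow> nat" where
  "integral_valuation K \<pp> x =
     (GREATEST n. x \<in> \<pp> [^]\<^bsub>ideals_set (ring_of_integers K)\<^esub> (n :: nat))"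

text \<open>The \<open>\<pp>\<close>-adic valuation, used only for nonzero \<open>x\<close>: extend from
  the ring of integers to its field of fractions \<open>K\<close>.\<close>

definition valuation :: "complex set \<Rightarrow> complex set \<Rightarrow> complex \<Rightarrow> int" where
  "valuation K \<pp> x = (THE k.
     \<exists>a \<in> carrier (ring_of_integers K) - {0}. \<exists>b \<in> carrier (ring_of_integers K) - {0}.
       x = a / b \<and> k = int (integral_valuation K \<pp> a) - int (integral_valuation K \<pp> b))"


section \<open>The uniform abc-conjecture\<close>

text \<open>Absolute logarithmic height of \<open>(a : b : c)\<close>. Summing over embeddings counts
  each real place once and each complex place twice, i.e. with its local degree. At a finite prime,
  \<open>log max(|a|, |b|, |c|) = - min(v a, v b, v c) log N(\<pp>)\<close>; the sum is restricted
  to the finitely many primes contributing a nonzero term.\<close>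

definition height3 :: "complex set \<Rightarrow> complex \<Rightarrow> complex \<Rightarrow> complex \<Rightarrow> real" where
  "height3 K a b c =
     (let m = (\<lambda>\<pp>. min (valuation K \<pp> a) (min (valuation K \<pp> b) (valuation K \<pp> c)))
      in ((\<Sum>\<sigma> \<in> nf_embeddings K. ln (max (cmod (\<sigma> a)) (max (cmod (\<sigma> b)) (cmod (\<sigma> c)))))
          + (\<Sum>\<pp> \<in> {\<pp> \<in> finite_primes K. m \<pp> \<noteq> 0}.
               - of_int (m \<pp>) * ln (real (prime_norm K \<pp>))))
         / real (nf_degree K))"

definition log_rad3 :: "complex set \<Rightarrow> complex \<Rightarrow> complex \<Rightarrow> complex \<Rightarrow> real" where
  "log_rad3 K a b c =
     (\<Sum>\<pp> \<in> {\<pp> \<in> finite_primes K.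
               \<not> (valuation K \<pp> a = valuation K \<pp> b \<and> valuation K \<pp> b = valuation K \<pp> c)}.
        ln (real (prime_norm K \<pp>))) / real (nf_degree K)"

definition uniform_abc_conjecture :: bool where
  "uniform_abc_conjecture \<longleftrightarrow>
     (\<forall>\<epsilon>::real. \<epsilon> > 0 \<longrightarrow> (\<forall>d::nat. d \<ge> 1 \<longrightarrow> (\<exists>C::real. \<forall>K. number_field K \<and> nf_degree K \<le> d \<longrightarrow>
        (\<forall>a \<in> K - {0}. \<forall>b \<in> K - {0}. \<forall>c \<in> K - {0}. a + b + c = 0 \<longrightarrow>
           height3 K a b c
             \<le> (1 + \<epsilon>) * (log_rad3 K a b c + ln \<bar>real_of_int (nf_disc K)\<bar>) + C))))"


section \<open>Elliptic curves over the rationals\<close>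

text \<open>The curve \<open>y\<^sup>2 + a1 x y + a3 y = x\<^sup>3 + a2 x\<^sup>2 + a4 x + a6\<close>.\<close>

record int_weierstrass =
  a1 :: int
  a2 :: int
  a3 :: int
  a4 :: int
  a6 :: int

definition weierstrass_disc :: "int_weierstrass \<Rightarrow> int" where
  "weierstrass_disc E =
     (let b2 = (a1 E)\<^sup>2 + 4 * a2 E;
          b4 = 2 * a4 E + a1 E * a3 E;
          b6 = (a3 E)\<^sup>2 + 4 * a6 E;
          b8 = (a1 E)\<^sup>2 * a6 E + 4 * a2 E * a6 E - a1 E * a3 E * a4 E
               + a2 E * (a3 E)\<^sup>2 - (a4 E)\<^sup>2
      in - b2\<^sup>2 * b8 - 8 * b4 ^ 3 - 27 * b6\<^sup>2 + 9 * b2 * b4 * b6)"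

definition elliptic_curve :: "int_weierstrass \<Rightarrow> bool" where
  "elliptic_curve E \<longleftrightarrow> weierstrass_disc E \<noteq> 0"

datatype rat_point = Infinity | Affine rat rat

definition on_curve :: "int_weierstrass \<Rightarrow> rat \<Rightarrow> rat \<Rightarrow> bool" where
  "on_curve E x y \<longleftrightarrow>
     y\<^sup>2 + of_int (a1 E) * x * y + of_int (a3 E) * y
       = x ^ 3 + of_int (a2 E) * x\<^sup>2 + of_int (a4 E) * x + of_int (a6 E)"

definition rational_points :: "int_weierstrass \<Rightarrow> rat_point set" where
  "rational_points E = insert Infinity {Affine x y | x y. on_curve E x y}"

definition point_repr :: "rat_point \<Rightarrow> int \<Rightarrow> int \<Rightarrow> int \<Rightarrow> bool" where
  "point_repr P a b d \<longleftrightarrow>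
     d \<ge> 1 \<and> gcd d (a * b) = 1 \<and>
     P = Affine (of_int a / of_int d ^ 2) (of_int b / of_int d ^ 3)"

text \<open>If \<open>point_a P = 0\<close>, then \<open>ln \<bar>point_a P\<bar>\<close> is 0
  in HOL instead of minus infinity; since \<open>point_d P \<ge> 1\<close>, its maximum with
  \<open>ln (point_d P)\<close> is the same.\<close>

definition point_a :: "rat_point \<Rightarrow> int" where
  "point_a P = (THE a. \<exists>b d. point_repr P a b d)"

definition point_d :: "rat_point \<Rightarrow> int" where
  "point_d P = (THE d. \<exists>a b. point_repr P a b d)"

definition rad :: "int \<Rightarrow> int" where
  "rad n = \<Prod>(prime_factors n)"

lemma point_repr_exists:
  assumes "P \<in> rational_points E - {Infinity}"
  shows "\<exists>a b d. point_repr P a b d"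
proof -
  obtain x y where P: "P = Affine x y" and xy: "on_curve E x y"
    using assms by (auto simp: rational_points_def)
  obtain m e where "quotient_of x = (m, e)" by force
  then have e: "e > 0" "coprime m e" "x = of_int m / of_int e"
    using quotient_of_denom_pos quotient_of_coprime quotient_of_div by blast+
  obtain n f where "quotient_of y = (n, f)" by force
  then have f: "f > 0" "coprime n f" "y = of_int n / of_int f"
    using quotient_of_denom_pos quotient_of_coprime quotient_of_div by blast+
  define M where "M = m ^ 3 + e * (a2 E * m\<^sup>2 + a4 E * m * e + a6 E * e\<^sup>2)"
  have cM: "coprime e M"
  proof -
    have "coprime e (m ^ 3)" using e(2) by (simp add: coprime_commute)
    then show ?thesis unfolding M_def coprime_iff_gcd_eq_1
      using gcd_add_mult[of e "a2 E * m\<^sup>2 + a4 E * m * e + a6 E * e\<^sup>2" "m ^ 3"]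
      by (simp add: ac_simps)
  qed
  have eq: "e ^ 3 * n\<^sup>2 + a1 E * e\<^sup>2 * f * m * n + a3 E * e ^ 3 * f * n = f\<^sup>2 * M"
  proof -
    have me: "rat_of_int m = x * of_int e" and nf: "rat_of_int n = y * of_int f"
      using e(1,3) f(1,3) by simp_all
    have "(of_int (e ^ 3 * n\<^sup>2 + a1 E * e\<^sup>2 * f * m * n + a3 E * e ^ 3 * f * n) :: rat)
           = of_int (e ^ 3 * f\<^sup>2) * (y\<^sup>2 + of_int (a1 E) * x * y + of_int (a3 E) * y)"
      by (simp add: me nf algebra_simps power2_eq_square power3_eq_cube)
    also have "\<dots> = of_int (e ^ 3 * f\<^sup>2)
           * (x ^ 3 + of_int (a2 E) * x\<^sup>2 + of_int (a4 E) * x + of_int (a6 E))"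
      using xy unfolding on_curve_def by simp
    also have "\<dots> = of_int (f\<^sup>2 * M)"
      unfolding M_def by (simp add: me algebra_simps power2_eq_square power3_eq_cube)
    finally show ?thesis by (simp only: of_int_eq_iff)
  qed
  have "e\<^sup>2 dvd f\<^sup>2 * M"
    unfolding eq[symmetric] by (intro dvd_add) (simp_all add: power2_eq_square power3_eq_cube)
  moreover have "coprime (e\<^sup>2) M" using cM by simp
  ultimately have "e\<^sup>2 dvd f\<^sup>2" by (simp add: coprime_dvd_mult_left_iff)
  then have "e dvd f" by simp
  then obtain g where g: "f = e * g" by blast
  have gpos: "g > 0" using e(1) f(1) g by (simp add: zero_less_mult_iff)
  define N where "N = n\<^sup>2 + g * (a1 E * m * n + a3 E * e * n)"
  have "e\<^sup>2 * (e * N) = e\<^sup>2 * (g\<^sup>2 * M)"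
    using eq unfolding g N_def by (simp add: algebra_simps power2_eq_square power3_eq_cube)
  then have eq2: "e * N = g\<^sup>2 * M" using e(1) by simp
  have cgn: "coprime g n" using f(2) g by (simp add: coprime_commute)
  have cN: "coprime g N"
  proof -
    have "coprime g (n\<^sup>2)" using cgn by simp
    then show ?thesis unfolding N_def coprime_iff_gcd_eq_1
      using gcd_add_mult[of g "a1 E * m * n + a3 E * e * n" "n\<^sup>2"]
      by (simp add: ac_simps)
  qed
  have "e dvd g\<^sup>2 * M" using eq2 by (metis dvd_triv_left)
  then have "e dvd g\<^sup>2" using cM by (simp add: coprime_dvd_mult_left_iff)
  moreover have "g\<^sup>2 dvd e * N" using eq2 by simp
  then have "g\<^sup>2 dvd e" using cN by (simp add: coprime_dvd_mult_left_iff)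
  ultimately have eg: "e = g\<^sup>2" using e(1) gpos by (simp add: zdvd_antisym_nonneg)
  have "coprime g m" using e(2) eg by (simp add: coprime_commute)
  then have "gcd g (m * n) = 1" using cgn by simp
  moreover have "f = g ^ 3" using g eg by (simp add: power2_eq_square power3_eq_cube)
  ultimately have "point_repr P m n g"
    using gpos e(3) f(3) eg P by (simp add: point_repr_def)
  then show ?thesis by blast
qed

lemma point_repr_unique:
  assumes "point_repr P a b d" "point_repr P a' b' d'"
  shows "a = a'" "b = b'" "d = d'"
proof -
  have q: "quotient_of (of_int u / of_int w ^ 2) = (u, w\<^sup>2)"
    if "w \<ge> 1" "gcd w (u * v) = 1" for u v w :: int
  proof -
    have "coprime u (w\<^sup>2)" using that(2) by (simp add: coprime_iff_gcd_eq_1[symmetric] coprime_commute)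
    moreover have "(of_int u / of_int w ^ 2 :: rat) = Rat.Fract u (w\<^sup>2)"
      by (simp add: Rat.Fract_of_int_quotient)
    ultimately show ?thesis using that(1) by (simp add: quotient_of_Fract Rat.normalize_stable)
  qed
  have r: "d \<ge> 1" "gcd d (a * b) = 1" "d' \<ge> 1" "gcd d' (a' * b') = 1"
    using assms unfolding point_repr_def by blast+
  have "Affine (of_int a / of_int d ^ 2) (of_int b / of_int d ^ 3)
      = Affine (of_int a' / of_int d' ^ 2) (of_int b' / of_int d' ^ 3)"
    using assms unfolding point_repr_def by metis
  then have x: "(of_int a / of_int d ^ 2 :: rat) = of_int a' / of_int d' ^ 2"
    and y: "(of_int b / of_int d ^ 3 :: rat) = of_int b' / of_int d' ^ 3"
    by (simp_all only: rat_point.inject)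
  have "(a, d\<^sup>2) = (a', d'\<^sup>2)"
    using q[OF r(1,2)] q[OF r(3,4)] unfolding x by (rule trans[OF sym])
  then have "a = a'" and "d\<^sup>2 = d'\<^sup>2" by simp_all
  then show "a = a'" and d: "d = d'" using r(1,3) by (simp_all add: power2_eq_iff)
  show "b = b'" using y r(1) unfolding d by simp
qed

lemma point_repr_iff:
  assumes "P \<in> rational_points E - {Infinity}"
  shows "(\<exists>b. point_repr P a b d) \<longleftrightarrow> a = point_a P \<and> d = point_d P"
proof -
  obtain a0 b0 d0 where r: "point_repr P a0 b0 d0" using point_repr_exists[OF assms] by blast
  have "point_a P = a0" unfolding point_a_def
    using r by (intro the_equality) (blast dest: point_repr_unique(1))+
  moreover have "point_d P = d0" unfolding point_d_def
    using r by (intro the_equality) (blast dest: point_repr_unique(3))+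
  ultimately show ?thesis using r by (blast dest: point_repr_unique(1,3))
qed

end

theory Submission
  imports Defs
begin

text \<open>
  Only the case \<open>K = \<rat>\<close> of the abc-conjecture is needed, through Elkies' argument with a Belyi map.
  For a squarefree \<open>S \<in> \<rat>[x]\<close> consider the inequality
  \<open>(deg S - 1 - \<epsilon>) h(x) \<le> \<Sum> log p + O(1)\<close>, where the sum ranges over the primes at which
  \<open>x\<close> meets the divisor \<open>(S = 0) + (\<infinity>)\<close>. For \<open>S = x (x - 1)\<close> it is the abc-conjecture. It pulls
  back along polynomial maps \<open>\<Phi>\<close> whose finite critical values are roots of \<open>S\<close>, because then, by
  Riemann--Hurwitz, the number of points over \<open>(S = 0)\<close> is \<open>deg \<Phi> (deg S - 1) + 1\<close>; and it is
  inherited by factors of \<open>S\<close>. Explicit maps \<open>\<Phi>\<close> lead from \<open>x (x - 1)\<close> to every separable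
  cubic. For the cubic \<open>F\<close> with \<open>F(x) = (2 y + a1 x + a3)\<^sup>2\<close> on the curve, the points above
  \<open>F = 0\<close> contribute at most \<open>\<onehalf> log |F|\<close>, that is \<open>3/2 h(x)\<close>, so that
  \<open>(1/2 - \<epsilon>) h(x) \<le> log rad(d) + O(1)\<close>.
\<close>

section \<open>The abc-conjecture over the rationals\<close>

text \<open>The roots of a cubic over the rationals are usually irrational, and a map adapted to
  them one by one would call for the abc-conjecture over their splitting field. Hence the inequality
  is stated for a whole polynomial \<open>S\<close> with rational coefficients instead of for single
  points. The square of the odd part of a depressed cubic takes one rational value at all three
  roots and has rational critical values, which leaves a question about rational points of the line.

  The coefficient deg S - 1 is the degree of (S = 0) + (\<infinity>) plus that of the canonical
  divisor, -2. Keeping \<infinity> in the divisor suits polynomial maps, which are totally ramified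
  there: if all finite critical values of a map of degree n are roots of S, then exactly n - 1 of
  the n deg S preimages, counted with multiplicity, are lost to ramification, and n deg S - (n - 1)
  = n (deg S - 1) + 1. So truncated counting loses nothing in a pullback. For a cubic the
  coefficient 2 beats the cost 3/2 of the three finite branch points of the double cover x, each of
  which has ramification index two.\<close>

lemma complex_ring_simps [simp]:
  "carrier complex_ring = UNIV" "x \<otimes>\<^bsub>complex_ring\<^esub> y = x * y" "\<one>\<^bsub>complex_ring\<^esub> = 1"
  "\<zero>\<^bsub>complex_ring\<^esub> = 0" "x \<oplus>\<^bsub>complex_ring\<^esub> y = x + y"
  by (simp_all add: complex_ring_def)

lemma field_complex_ring: "field complex_ring"
proof -
  have "cring complex_ring"
    by (intro cringI abelian_groupI comm_monoidI) (auto simp: algebra_simps add_eq_0_iff)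
  moreover have "Units complex_ring = carrier complex_ring - {\<zero>\<^bsub>complex_ring\<^esub>}"
  proof -
    have "\<exists>y. y * x = 1 \<and> x * y = 1" if "x \<noteq> 0" for x :: complex
      using that by (intro exI[of _ "inverse x"]) simp
    then show ?thesis by (auto simp: Units_def)
  qed
  ultimately show ?thesis by (rule cring.cring_fieldI)
qed

lemma cring_subring_complex_ring:
  assumes "1 \<in> H" "\<And>x y. x \<in> H \<Longrightarrow> y \<in> H \<Longrightarrow> x - y \<in> H"
    "\<And>x y. x \<in> H \<Longrightarrow> y \<in> H \<Longrightarrow> x * y \<in> H"
  shows "cring (complex_ring\<lparr>carrier := H\<rparr>)"
proof -
  have z: "0 \<in> H" using assms(2)[OF assms(1) assms(1)] by simp
  have n: "- x \<in> H" if "x \<in> H" for x using assms(2)[OF z that] by simp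
  have p: "x + y \<in> H" if "x \<in> H" "y \<in> H" for x y using assms(2)[OF that(1) n[OF that(2)]] by simp
  show ?thesis
    using assms(1,3) z n p
    by (intro cringI abelian_groupI comm_monoidI) (auto simp: algebra_simps add_eq_0_iff)
qed

lemma subfield_Rats: "subfield \<rat> complex_ring"
proof -
  interpret field complex_ring by (rule field_complex_ring)
  have "field (complex_ring\<lparr>carrier := \<rat>\<rparr>)"
  proof (rule cring.cring_fieldI)
    show "cring (complex_ring\<lparr>carrier := \<rat>\<rparr>)" by (rule cring_subring_complex_ring) auto
    show "Units (complex_ring\<lparr>carrier := \<rat>\<rparr>)
        = carrier (complex_ring\<lparr>carrier := \<rat>\<rparr>) - {\<zero>\<^bsub>complex_ring\<lparr>carrier := \<rat>\<rparr>\<^esub>}"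
    proof -
      have "\<exists>y\<in>\<rat>. y * x = 1 \<and> x * y = 1" if "x \<noteq> 0" "x \<in> \<rat>" for x :: complex
        using that by (intro bexI[of _ "inverse x"]) simp_all
      then show ?thesis by (auto simp: Units_def)
    qed
  qed
  then show ?thesis using subfield_iff(1)[of \<rat>] by simp
qed

lemma number_field_Rats: "number_field \<rat>"
  and nf_degree_Rats: "nf_degree \<rat> = 1"
proof -
  interpret field complex_ring by (rule field_complex_ring)
  have d: "dimension 1 \<rat> \<rat>" by (rule dimension_one[OF subfield_Rats])
  then show "number_field \<rat>"
    using subfield_Rats unfolding number_field_def finite_dimension_def by blast
  show "nf_degree \<rat> = 1"
    unfolding nf_degree_def over_def dim_def
    using d dimension_is_inj[OF subfield_Rats] by blast
qed

lemma nf_embeddings_Rats: "nf_embeddings \<rat> = {restrict id \<rat>}"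
proof -
  have "\<sigma> x = x"
    if \<sigma>: "\<sigma> \<in> Ring.ring_hom (complex_ring\<lparr>carrier := \<rat>\<rparr>) complex_ring" and x: "x \<in> \<rat>" for \<sigma> x
  proof -
    have a: "\<sigma> (u + v) = \<sigma> u + \<sigma> v" "\<sigma> (u * v) = \<sigma> u * \<sigma> v"
      if "u \<in> \<rat>" "v \<in> \<rat>" for u v
      using ring_hom_add[OF \<sigma>, of u v] ring_hom_mult[OF \<sigma>, of u v] that by simp_all
    have o: "\<sigma> 1 = 1" using ring_hom_one[OF \<sigma>] by simp
    have z: "\<sigma> 0 = 0" using a(1)[of 0 0] by simp
    have n: "\<sigma> (of_nat k) = of_nat k" for k
      by (induction k) (simp_all add: z a o)
    have i: "\<sigma> (of_int k) = of_int k" for k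
    proof (cases k)
      case (neg m)
      have "\<sigma> (of_int k) + \<sigma> (of_nat (Suc m)) = 0"
        using a(1)[of "of_int k" "of_nat (Suc m)"] z neg by simp
      then show ?thesis unfolding n neg by (simp add: add_eq_0_iff2)
    qed (simp add: n)
    from x obtain m k where mk: "k \<noteq> 0" "x = of_int m / of_int k"
      by (metis Rats_cases' less_irrefl of_int_eq_0_iff)
    have "\<sigma> x * of_int k = of_int m"
      using a(2)[OF x, of "of_int k"] i mk by simp
    then have "\<sigma> x = of_int m / of_int k" using mk(1) by (simp add: eq_divide_eq)
    then show ?thesis using mk(2) by simp
  qed
  moreover have "restrict id \<rat> \<in> Ring.ring_hom (complex_ring\<lparr>carrier := \<rat>\<rparr>) complex_ring"
    by (rule ring_hom_memI) auto
  ultimately show ?thesis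
    unfolding nf_embeddings_def by (auto simp: extensional_def restrict_def)
qed

lemma carrier_integers_Rats: "carrier (ring_of_integers \<rat>) = \<int>"
  using rational_algebraic_int_is_int int_imp_algebraic_int Ints_subset_Rats
  by (auto simp: ring_of_integers_def)

lemma ring_of_integers_Rats: "ring_of_integers \<rat> = complex_ring\<lparr>carrier := \<int>\<rparr>"
  using carrier_integers_Rats by (simp add: ring_of_integers_def)

lemma ring_of_integers_Rats_simps [simp]:
  "x \<otimes>\<^bsub>ring_of_integers \<rat>\<^esub> y = x * y" "\<one>\<^bsub>ring_of_integers \<rat>\<^esub> = 1"
  "\<zero>\<^bsub>ring_of_integers \<rat>\<^esub> = 0" "x \<oplus>\<^bsub>ring_of_integers \<rat>\<^esub> y = x + y"
  by (simp_all add: ring_of_integers_Rats)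

lemma integral_basis_Rats:
  "integral_basis \<rat> \<omega> \<longleftrightarrow> \<omega> = [1] \<or> \<omega> = [-1]"
proof
  assume \<omega>: "integral_basis \<rat> \<omega>"
  define f where "f c = (\<Sum>i<length \<omega>. of_int (c ! i) * \<omega> ! i)" for c :: "int list"
  have ex: "\<exists>!c. length c = length \<omega> \<and> x = f c" if "x \<in> \<int>" for x
    using \<omega> that unfolding integral_basis_def carrier_integers_Rats f_def by blast
  have mem: "\<omega> ! i \<in> \<int>" if "i < length \<omega>" for i
    using \<omega> that unfolding integral_basis_def carrier_integers_Rats by (meson nth_mem subsetD)
  have inj: "c = c'" if "length c = length \<omega>" "length c' = length \<omega>" "f c = f c'" for c c'
  proof -
    have "f c \<in> \<int>" unfolding f_def using mem by (intro Ints_sum) auto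
    then show ?thesis using ex[of "f c"] that by metis
  qed
  have nz: "\<omega> ! i \<noteq> 0" if i: "i < length \<omega>" for i
  proof
    assume 0: "\<omega> ! i = 0"
    have "f ((replicate (length \<omega>) 0)[i := 1]) = f (replicate (length \<omega>) 0)"
      unfolding f_def using 0 i by (intro sum.cong refl) (auto simp: nth_list_update)
    then have "(replicate (length \<omega>) (0::int))[i := 1] = replicate (length \<omega>) 0"
      by (intro inj) simp_all
    then show False using i by (metis length_replicate nth_list_update_eq nth_replicate zero_neq_one)
  qed
  have len: "length \<omega> = 1"
  proof (rule ccontr)
    assume l: "length \<omega> \<noteq> 1"
    have "length \<omega> \<noteq> 0" using ex[of 1] unfolding f_def by auto
    with l have l2: "1 < length \<omega>" by linarith
    have "0 < length \<omega>" using l2 by linarith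
    then obtain u where u: "\<omega> ! 0 = of_int u" using mem[of 0] by (auto elim: Ints_cases)
    obtain v where v: "\<omega> ! 1 = of_int v" using mem[OF l2] by (rule Ints_cases)
    note uv = u v
    let ?z = "replicate (length \<omega>) (0::int)"
    \<comment> \<open>Two integers \<open>u\<close>, \<open>v\<close> always satisfy the nontrivial
      relation v u - u v = 0, which contradicts uniqueness of coefficients.\<close>
    define c where "c = ?z[0 := v, 1 := - u]"
    have "f c = (\<Sum>i\<in>{0,1}. of_int (c ! i) * \<omega> ! i)"
      unfolding f_def
      by (rule sum.mono_neutral_right) (use l2 in \<open>auto simp: c_def nth_list_update\<close>)
    also have "\<dots> = 0" using l2 \<open>0 < length \<omega>\<close> uv by (simp add: c_def nth_list_update)
    finally have "f c = f ?z" unfolding f_def by simp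
    then have "c = ?z" by (intro inj) (simp_all add: c_def)
    then have "c ! 0 = 0" using \<open>0 < length \<omega>\<close> by simp
    moreover have "c ! 0 = v" using \<open>0 < length \<omega>\<close> by (simp add: c_def nth_list_update)
    ultimately show False using nz[OF l2] uv by simp
  qed
  then obtain w where w: "\<omega> = [w]" by (cases \<omega>) auto
  then obtain u where u: "w = of_int u" using mem[of 0] by (auto elim: Ints_cases)
  obtain c where "1 = f c" using ex[of 1] by auto
  then have "of_int (c ! 0 * u) = (1::complex)" unfolding f_def w u by simp
  then have "c ! 0 * u = 1" by (simp only: of_int_eq_1_iff)
  then show "\<omega> = [1] \<or> \<omega> = [-1]"
    using w u zmult_eq_1_iff by auto
next
  have "\<exists>!c::int list. length c = 1 \<and> x = of_int (c ! 0) * w"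
    if x: "x \<in> \<int>" and w: "w = 1 \<or> w = - 1" for x w :: complex
  proof -
    obtain k where k: "x = of_int k" using x by (rule Ints_cases)
    have "length c = 1 \<and> x = of_int (c ! 0) * w \<longleftrightarrow> c = [if w = 1 then k else - k]" for c :: "int list"
      using w k by (cases c) (auto simp: minus_equation_iff[of "of_int _"] simp flip: of_int_minus)
    then show ?thesis by simp
  qed
  note ex = this
  assume "\<omega> = [1] \<or> \<omega> = [-1]"
  then obtain w where w: "\<omega> = [w]" "w = 1 \<or> w = - 1" by blast
  have "w \<in> \<int>" using w(2) by auto
  then show "integral_basis \<rat> \<omega>"
    unfolding integral_basis_def carrier_integers_Rats w(1) using ex[OF _ w(2)] by simp
qed

text \<open>Both integral bases have a 1 by 1 determinant equal to 1 or -1, so the square determines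
  \<open>D\<close> uniquely. The discriminant term of the abc inequality thereby vanishes.\<close>

lemma nf_disc_Rats: "nf_disc \<rat> = 1"
proof -
  have "(distinct \<sigma> \<and> set \<sigma> = nf_embeddings \<rat> \<and> integral_basis \<rat> \<omega> \<and>
     of_int D = (det (mat (nf_degree \<rat>) (nf_degree \<rat>) (\<lambda>(i, j). (\<sigma> ! i) (\<omega> ! j))))\<^sup>2)
     \<longleftrightarrow> \<sigma> = [restrict id \<rat>] \<and> (\<omega> = [1] \<or> \<omega> = [-1]) \<and> D = 1" for \<sigma> \<omega> D
  proof -
    have s: "distinct \<sigma> \<and> set \<sigma> = {restrict id \<rat>} \<longleftrightarrow> \<sigma> = [restrict id \<rat>]"
    proof
      assume \<sigma>: "distinct \<sigma> \<and> set \<sigma> = {restrict id \<rat>}"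
      then have "length \<sigma> = 1" using distinct_card[of \<sigma>] by simp
      then show "\<sigma> = [restrict id \<rat>]" using \<sigma> by (cases \<sigma>) auto
    qed simp
    show ?thesis
      unfolding nf_embeddings_Rats nf_degree_Rats integral_basis_Rats conj_assoc[symmetric] s
      by (auto simp: det_single)
  qed
  then show ?thesis unfolding nf_disc_def by auto
qed


section \<open>Prime ideals of the integers, their valuations and norms\<close>

definition int_multiples :: "int \<Rightarrow> complex set" where
  "int_multiples n = range (\<lambda>k. of_int (n * k))"

lemma of_int_in_int_multiples_iff [simp]: "of_int k \<in> int_multiples n \<longleftrightarrow> n dvd k"
  by (auto simp: int_multiples_def dvd_def simp del: of_int_mult)

lemma int_multiples_cases:
  assumes "x \<in> int_multiples n"
  obtains k where "x = of_int (n * k)"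
  using assms by (auto simp: int_multiples_def)

lemma ideal_prod_int_multiples:
  "ideal_prod (ring_of_integers \<rat>) (int_multiples m) (int_multiples n) = int_multiples (m * n)"
proof
  show "ideal_prod (ring_of_integers \<rat>) (int_multiples m) (int_multiples n) \<subseteq> int_multiples (m * n)"
  proof
    fix x assume "x \<in> ideal_prod (ring_of_integers \<rat>) (int_multiples m) (int_multiples n)"
    then show "x \<in> int_multiples (m * n)"
    proof induction
      case (prod i j)
      then obtain k l where "i = of_int (m * k)" "j = of_int (n * l)"
        by (meson int_multiples_cases)
      then have "i * j = of_int ((m * n) * (k * l))" by simp
      then show ?case by (simp only: ring_of_integers_Rats_simps of_int_in_int_multiples_iff) simp
    next
      case (sum s t)
      then obtain k l where "s = of_int (m * n * k)" "t = of_int (m * n * l)"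
        by (meson int_multiples_cases)
      then have "s + t = of_int ((m * n) * (k + l))" by (simp add: algebra_simps)
      then show ?case by (simp only: ring_of_integers_Rats_simps of_int_in_int_multiples_iff) simp
    qed
  qed
  show "int_multiples (m * n) \<subseteq> ideal_prod (ring_of_integers \<rat>) (int_multiples m) (int_multiples n)"
  proof
    fix x assume "x \<in> int_multiples (m * n)"
    then obtain k where "x = of_int (m * n * k)" by (rule int_multiples_cases)
    then have x: "x = of_int m \<otimes>\<^bsub>ring_of_integers \<rat>\<^esub> of_int (n * k)" by simp
    show "x \<in> ideal_prod (ring_of_integers \<rat>) (int_multiples m) (int_multiples n)"
      unfolding x by (rule ideal_prod.prod) (simp_all del: of_int_mult)
  qed
qed

lemma int_multiples_power:
  "int_multiples p [^]\<^bsub>ideals_set (ring_of_integers \<rat>)\<^esub> (n :: nat) = int_multiples (p ^ n)"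
proof (induction n)
  case 0
  have "\<int> = int_multiples 1" by (auto simp: Ints_def int_multiples_def)
  then show ?case by (simp add: nat_pow_def ideals_set_def carrier_integers_Rats)
next
  case (Suc n)
  have "int_multiples p [^]\<^bsub>ideals_set (ring_of_integers \<rat>)\<^esub> Suc n
      = ideal_prod (ring_of_integers \<rat>)
          (int_multiples p [^]\<^bsub>ideals_set (ring_of_integers \<rat>)\<^esub> n) (int_multiples p)"
    by (simp add: nat_pow_def ideals_set_def)
  then show ?case unfolding Suc ideal_prod_int_multiples by (simp add: mult.commute)
qed

lemma integral_valuation_Rats:
  assumes "prime p" "k \<noteq> 0"
  shows "integral_valuation \<rat> (int_multiples p) (of_int k) = multiplicity p k"
proof -
  have "(p ^ n dvd k) = (n \<le> multiplicity p k)" for n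
    using assms by (intro power_dvd_iff_le_multiplicity) (auto simp: not_prime_unit)
  then show ?thesis
    unfolding integral_valuation_def int_multiples_power of_int_in_int_multiples_iff
    by (intro Greatest_equality) auto
qed

text \<open>Any presentation of \<open>k\<close> as a quotient a / b gives a = k b, and additivity
  of multiplicities makes the difference of valuations independent of the presentation, as the
  definite description requires.\<close>

lemma valuation_Rats:
  assumes p: "prime p" and k: "k \<noteq> 0"
  shows "valuation \<rat> (int_multiples p) (of_int k) = int (multiplicity p k)"
  unfolding valuation_def carrier_integers_Rats
proof (rule the_equality)
  show "\<exists>a\<in>\<int> - {0}. \<exists>b\<in>\<int> - {0}. of_int k = a / b \<and>
      int (multiplicity p k) = int (integral_valuation \<rat> (int_multiples p) a)
        - int (integral_valuation \<rat> (int_multiples p) b)"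
    using assms integral_valuation_Rats[OF p, of 1]
    by (intro bexI[of _ "of_int k"] bexI[of _ 1]) (auto simp: integral_valuation_Rats)
next
  fix v assume "\<exists>a\<in>\<int> - {0}. \<exists>b\<in>\<int> - {0}. of_int k = a / b \<and>
      v = int (integral_valuation \<rat> (int_multiples p) a)
        - int (integral_valuation \<rat> (int_multiples p) b)"
  then obtain a b where ab: "a \<noteq> 0" "b \<noteq> 0" "(of_int k :: complex) = of_int a / of_int b"
    "v = int (integral_valuation \<rat> (int_multiples p) (of_int a))
        - int (integral_valuation \<rat> (int_multiples p) (of_int b))"
    by (auto elim!: Ints_cases)
  have "(of_int (k * b) :: complex) = of_int a" using ab by simp
  then have "a = k * b" by (simp only: of_int_eq_iff)
  then show "v = int (multiplicity p k)"
    using ab p k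
    by (simp add: integral_valuation_Rats prime_elem_multiplicity_mult_distrib[OF prime_imp_prime_elem] del: of_int_mult)
qed

text \<open>Division with remainder by the least positive element shows that the ideal is principal;
  its primality then passes to the generator.\<close>

lemma finite_primes_Rats:
  assumes "\<pp> \<in> finite_primes \<rat>"
  obtains p :: int where "prime p" "\<pp> = int_multiples p"
proof -
  interpret primeideal \<pp> "ring_of_integers \<rat>" using assms by (simp add: finite_primes_def)
  have sub: "\<pp> \<subseteq> \<int>" using a_subset carrier_integers_Rats by simp
  define I where "I = {n :: int. of_int n \<in> \<pp>}"
  have Iadd: "m + n \<in> I" if "m \<in> I" "n \<in> I" for m n
    using additive_subgroup.a_closed[OF is_additive_subgroup, of "of_int m" "of_int n"] that
    by (simp add: I_def)
  have Imult: "k * n \<in> I" if "n \<in> I" for k n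
    using I_l_closed[of "of_int n" "of_int k"] that by (simp add: I_def carrier_integers_Rats)
  have "\<exists>x\<in>\<pp>. x \<noteq> 0" using assms additive_subgroup.zero_closed[OF is_additive_subgroup]
    by (auto simp: finite_primes_def)
  then obtain n0 where n0: "n0 \<in> I" "n0 \<noteq> 0" using sub by (auto simp: I_def elim!: Ints_cases)
  define p where "p = int (LEAST n. n > 0 \<and> int n \<in> I)"
  have "nat \<bar>n0\<bar> > 0 \<and> int (nat \<bar>n0\<bar>) \<in> I"
    using n0 Imult[of n0 "sgn n0"] by (simp add: abs_sgn[symmetric] mult.commute)
  then have p: "p > 0" "p \<in> I" 
    using LeastI[of "\<lambda>n. n > 0 \<and> int n \<in> I" "nat \<bar>n0\<bar>"] unfolding p_def by simp_all
  have least: "p \<le> n" if "n > 0" "n \<in> I" for n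
    using Least_le[of "\<lambda>n. n > 0 \<and> int n \<in> I" "nat n"] that unfolding p_def by simp
  have I: "n \<in> I \<longleftrightarrow> p dvd n" for n
  proof
    assume n: "n \<in> I"
    have "n mod p = n + (- (n div p)) * p" by (simp add: minus_div_mult_eq_mod[symmetric])
    then have "n mod p \<in> I" using Iadd[OF n Imult[OF p(2)]] by metis
    then have "\<not> n mod p > 0" using least[of "n mod p"] pos_mod_bound[OF p(1), of n] by linarith
    then show "p dvd n" using pos_mod_sign[OF p(1), of n] by (simp add: dvd_eq_mod_eq_0)
  next
    assume "p dvd n" then show "n \<in> I" using Imult[OF p(2)] by (auto simp: dvd_def mult.commute)
  qed
  have eq: "\<pp> = int_multiples p"
  proof (intro Set.set_eqI iffI)
    fix x assume x: "x \<in> \<pp>"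
    then obtain n where "x = of_int n" using sub by (auto elim!: Ints_cases)
    then show "x \<in> int_multiples p" using x I[of n] by (simp add: I_def)
  next
    fix x assume "x \<in> int_multiples p"
    then obtain k where "x = of_int (p * k)" by (rule int_multiples_cases)
    then show "x \<in> \<pp>" using I[of "p * k"] by (simp add: I_def)
  qed
  have "prime p"
  proof (rule primeI)
    have "p \<noteq> 1" using I_notcarr unfolding carrier_integers_Rats eq 
      by (auto simp: int_multiples_def elim!: Ints_cases)
    then have "\<not> is_unit p" using p(1) by simp
    moreover have "p dvd a \<or> p dvd b" if "p dvd a * b" for a b
      using I_prime[of "of_int a" "of_int b"] that
        of_int_in_int_multiples_iff[of "a * b" p]
      unfolding carrier_integers_Rats eq by simp
    ultimately show "prime_elem p" using p(1) by (intro prime_elemI) auto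
    show "normalize p = p" using p(1) by simp
  qed
  then show ?thesis using eq that by blast
qed

text \<open>Every coset has a representative among 0, ..., p - 1. An upper bound suffices because,
  for coprime arguments, norms enter only through the radical, on the larger side of the abc
  inequality.\<close>

lemma prime_norm_Rats_le:
  assumes p: "prime p"
  shows "prime_norm \<rat> (int_multiples p) \<le> nat p"
proof -
  let ?R = "ring_of_integers \<rat>"
  let ?c = "\<lambda>k::int. int_multiples p +>\<^bsub>?R\<^esub> of_int k"
  have "carrier (?R Quot int_multiples p) \<subseteq> ?c ` {0..<p}"
  proof
    fix X assume "X \<in> carrier (?R Quot int_multiples p)"
    then obtain k where X: "X = ?c k"
      by (auto simp: FactRing_def A_RCOSETS_def' a_r_coset_def' carrier_integers_Rats elim!: Ints_cases)
    have "?c k = ?c (k mod p)"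
    proof (intro Set.set_eqI iffI)
      fix x assume "x \<in> ?c k"
      then obtain l where "x = of_int (p * l) + of_int k"
        by (force simp: a_r_coset_def' elim!: int_multiples_cases)
      then have "x = of_int (p * (l + k div p) + k mod p)" by (simp add: algebra_simps)
      then have x: "x = of_int (p * (l + k div p)) + of_int (k mod p)" by simp
      have "of_int (p * (l + k div p)) \<in> int_multiples p"
        unfolding of_int_in_int_multiples_iff by simp
      then show "x \<in> ?c (k mod p)" using x by (auto simp: a_r_coset_def')
    next
      fix x assume "x \<in> ?c (k mod p)"
      then obtain l where "x = of_int (p * l) + of_int (k mod p)"
        by (force simp: a_r_coset_def' elim!: int_multiples_cases)
      then have "x = of_int (p * (l - k div p) + (p * (k div p) + k mod p))"
        by (simp only: of_int_add of_int_mult of_int_diff algebra_simps)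
      then have x: "x = of_int (p * (l - k div p)) + of_int k" by simp
      have "of_int (p * (l - k div p)) \<in> int_multiples p"
        unfolding of_int_in_int_multiples_iff by simp
      then show "x \<in> ?c k" using x by (auto simp: a_r_coset_def')
    qed
    then show "X \<in> ?c ` {0..<p}" using X prime_gt_0_int[OF p] by auto
  qed
  then have "prime_norm \<rat> (int_multiples p) \<le> card (?c ` {0..<p})"
    unfolding prime_norm_def by (intro card_mono) simp_all
  also have "\<dots> \<le> card {0..<p}" by (rule card_image_le) simp
  finally show ?thesis by simp
qed

lemma ln_of_nat_nonneg: "ln (real n) \<ge> 0"
  by (cases "n = 0") auto

text \<open>For coprime \<open>a\<close> and \<open>b\<close> the minimum of the valuations is 0 at
  every prime, so the height reduces to its archimedean term, and only primes dividing
  \<open>a * b * c\<close> can occur in the radical.\<close>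

lemma abc_integers:
  assumes abc: "uniform_abc_conjecture" and \<epsilon>: "\<epsilon> > 0"
  obtains C where "\<And>a b c :: int. a \<noteq> 0 \<Longrightarrow> b \<noteq> 0 \<Longrightarrow> c \<noteq> 0 \<Longrightarrow> a + b + c = 0 \<Longrightarrow> coprime a b \<Longrightarrow>
    ln (max \<bar>real_of_int a\<bar> (max \<bar>real_of_int b\<bar> \<bar>real_of_int c\<bar>))
      \<le> (1 + \<epsilon>) * (\<Sum>p\<in>prime_factors (a * b * c). ln (real_of_int p)) + C"
proof -
  have "\<exists>C. \<forall>K. number_field K \<and> nf_degree K \<le> 1 \<longrightarrow>
        (\<forall>a \<in> K - {0}. \<forall>b \<in> K - {0}. \<forall>c \<in> K - {0}. a + b + c = 0 \<longrightarrow>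
           height3 K a b c
             \<le> (1 + \<epsilon>) * (log_rad3 K a b c + ln \<bar>real_of_int (nf_disc K)\<bar>) + C)"
    using abc \<epsilon> unfolding uniform_abc_conjecture_def by (metis order_refl)
  then obtain C where C: "\<forall>K. number_field K \<and> nf_degree K \<le> 1 \<longrightarrow>
        (\<forall>a \<in> K - {0}. \<forall>b \<in> K - {0}. \<forall>c \<in> K - {0}. a + b + c = 0 \<longrightarrow>
           height3 K a b c
             \<le> (1 + \<epsilon>) * (log_rad3 K a b c + ln \<bar>real_of_int (nf_disc K)\<bar>) + C)" by blast
  have "ln (max \<bar>real_of_int a\<bar> (max \<bar>real_of_int b\<bar> \<bar>real_of_int c\<bar>))
      \<le> (1 + \<epsilon>) * (\<Sum>p\<in>prime_factors (a * b * c). ln (real_of_int p)) + C"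
    if nz: "a \<noteq> 0" "b \<noteq> 0" "c \<noteq> 0" and s: "a + b + c = 0" and cop: "coprime a b" for a b c :: int
  proof -
    have sC: "(of_int a + of_int b + of_int c :: complex) = 0"
      using s by (metis of_int_0 of_int_add)
    have h: "height3 \<rat> (of_int a) (of_int b) (of_int c)
      \<le> (1 + \<epsilon>) * log_rad3 \<rat> (of_int a) (of_int b) (of_int c) + C"
      using C[rule_format, of \<rat> "of_int a" "of_int b" "of_int c"] nz sC
      by (simp add: number_field_Rats nf_degree_Rats nf_disc_Rats)
    have "min (valuation \<rat> \<pp> (of_int a)) (min (valuation \<rat> \<pp> (of_int b)) (valuation \<rat> \<pp> (of_int c))) = 0"
      if \<pp>: "\<pp> \<in> finite_primes \<rat>" for \<pp>
    proof -
      obtain p where p: "prime p" "\<pp> = int_multiples p" using finite_primes_Rats[OF \<pp>] by blast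
      have "\<not> p dvd a \<or> \<not> p dvd b" using cop p(1) by (meson coprime_common_divisor not_prime_unit)
      then have "multiplicity p a = 0 \<or> multiplicity p b = 0"
        by (metis not_dvd_imp_multiplicity_0)
      then show ?thesis using nz p(1) by (auto simp: p(2) valuation_Rats)
    qed
    then have "height3 \<rat> (of_int a) (of_int b) (of_int c)
        = ln (max \<bar>real_of_int a\<bar> (max \<bar>real_of_int b\<bar> \<bar>real_of_int c\<bar>))"
      unfolding height3_def Let_def nf_embeddings_Rats nf_degree_Rats
      by (simp cong: conj_cong)
    moreover have "log_rad3 \<rat> (of_int a) (of_int b) (of_int c)
        \<le> (\<Sum>p\<in>prime_factors (a * b * c). ln (real_of_int p))"
    proof -
      define X where "X = {\<pp> \<in> finite_primes \<rat>.
               \<not> (valuation \<rat> \<pp> (of_int a) = valuation \<rat> \<pp> (of_int b)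
                  \<and> valuation \<rat> \<pp> (of_int b) = valuation \<rat> \<pp> (of_int c))}"
      have sub: "X \<subseteq> int_multiples ` prime_factors (a * b * c)"
      proof
        fix \<pp> assume "\<pp> \<in> X"
        then have \<pp>: "\<pp> \<in> finite_primes \<rat>" "\<not> (valuation \<rat> \<pp> (of_int a) = valuation \<rat> \<pp> (of_int b)
                  \<and> valuation \<rat> \<pp> (of_int b) = valuation \<rat> \<pp> (of_int c))" by (auto simp: X_def)
        obtain p where p: "prime p" "\<pp> = int_multiples p" using finite_primes_Rats[OF \<pp>(1)] by blast
        have "p dvd a * b * c"
        proof (rule ccontr)
          assume "\<not> p dvd a * b * c"
          then have "\<not> p dvd a" "\<not> p dvd b" "\<not> p dvd c" by auto
          then show False using \<pp>(2) nz p by (simp add: valuation_Rats not_dvd_imp_multiplicity_0)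
        qed
        then have "p \<in> prime_factors (a * b * c)" using p(1) nz by (simp add: prime_factors_dvd)
        then show "\<pp> \<in> int_multiples ` prime_factors (a * b * c)" using p(2) by blast
      qed
      have le: "ln (real (prime_norm \<rat> (int_multiples p))) \<le> ln (real_of_int p)"
        if "p \<in> prime_factors (a * b * c)" for p
      proof (cases "prime_norm \<rat> (int_multiples p) = 0")
        case False
        have p: "prime p" using that by auto
        have "real (prime_norm \<rat> (int_multiples p)) \<le> real_of_int p"
          using prime_norm_Rats_le[OF p] prime_gt_0_int[OF p] by linarith
        then show ?thesis using False by (intro ln_mono) auto
      next
        \<comment> \<open>The bound on the norm leaves the value 0 open; in that case
          \<open>ln 0 = 0\<close> in HOL.\<close>
        case True
        have "prime p" using that by auto
        then show ?thesis using True prime_ge_1_int[of p] by simp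
      qed
      have inj: "inj_on int_multiples (prime_factors (a * b * c))"
      proof (rule inj_onI)
        fix p q assume pq: "p \<in> prime_factors (a * b * c)" "q \<in> prime_factors (a * b * c)"
          "int_multiples p = int_multiples q"
        then have "p dvd q" "q dvd p" using of_int_in_int_multiples_iff by (metis dvd_refl)+
        moreover have "p \<ge> 0" "q \<ge> 0" using pq prime_ge_0_int by blast+
        ultimately show "p = q" by (simp add: zdvd_antisym_nonneg)
      qed
      have "log_rad3 \<rat> (of_int a) (of_int b) (of_int c) = (\<Sum>\<pp>\<in>X. ln (real (prime_norm \<rat> \<pp>)))"
        unfolding log_rad3_def nf_degree_Rats X_def by simp
      also have "\<dots> \<le> (\<Sum>\<pp>\<in>int_multiples ` prime_factors (a * b * c). ln (real (prime_norm \<rat> \<pp>)))"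
        using sub by (intro sum_mono2) (auto intro!: ln_of_nat_nonneg)
      also have "\<dots> = (\<Sum>p\<in>prime_factors (a * b * c). ln (real (prime_norm \<rat> (int_multiples p))))"
        using inj by (simp add: sum.reindex)
      also have "\<dots> \<le> (\<Sum>p\<in>prime_factors (a * b * c). ln (real_of_int p))"
        by (intro sum_mono le)
      finally show ?thesis .
    qed
    ultimately show ?thesis using h \<epsilon>
      by (smt (verit) mult_left_mono)
  qed
  then show ?thesis using that by blast
qed

section \<open>Integers and units at a prime\<close>

text \<open>For prime \<open>p\<close> this is the localization of the integers at \<open>p\<close>.
  Lowest terms are not demanded, so that sums and products need no reduction of fractions.\<close>

definition loc_int :: "int \<Rightarrow> rat \<Rightarrow> bool" where
  "loc_int p y \<longleftrightarrow> (\<exists>u v. \<not> p dvd v \<and> y = of_int u / of_int v)"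

definition loc_unit :: "int \<Rightarrow> rat \<Rightarrow> bool" where
  "loc_unit p y \<longleftrightarrow> y \<noteq> 0 \<and> loc_int p y \<and> loc_int p (inverse y)"

lemma loc_int_of_int: "prime p \<Longrightarrow> loc_int p (of_int k)"
  unfolding loc_int_def by (intro exI[of _ k] exI[of _ 1]) (auto dest: not_prime_unit)

lemma loc_int_add:
  assumes "prime p" "loc_int p x" "loc_int p y"
  shows "loc_int p (x + y)"
proof -
  obtain u v where u: "\<not> p dvd v" "x = of_int u / of_int v" using assms(2) by (auto simp: loc_int_def)
  obtain u' v' where u': "\<not> p dvd v'" "y = of_int u' / of_int v'" using assms(3) by (auto simp: loc_int_def)
  have "v \<noteq> 0" "v' \<noteq> 0" using u(1) u'(1) by auto
  then have "x + y = of_int (u * v' + u' * v) / of_int (v * v')"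
    using u(2) u'(2) by (simp add: field_simps)
  moreover have "\<not> p dvd v * v'" using u(1) u'(1) assms(1) by (simp add: prime_dvd_mult_iff)
  ultimately show ?thesis unfolding loc_int_def by blast
qed

lemma loc_int_mult:
  assumes "prime p" "loc_int p x" "loc_int p y"
  shows "loc_int p (x * y)"
proof -
  obtain u v where u: "\<not> p dvd v" "x = of_int u / of_int v" using assms(2) by (auto simp: loc_int_def)
  obtain u' v' where u': "\<not> p dvd v'" "y = of_int u' / of_int v'" using assms(3) by (auto simp: loc_int_def)
  have "x * y = of_int (u * u') / of_int (v * v')" using u(2) u'(2) by simp
  moreover have "\<not> p dvd v * v'" using u(1) u'(1) assms(1) by (simp add: prime_dvd_mult_iff)
  ultimately show ?thesis unfolding loc_int_def by blast
qed

lemma loc_unit_mult: "prime p \<Longrightarrow> loc_unit p x \<Longrightarrow> loc_unit p y \<Longrightarrow> loc_unit p (x * y)"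
  by (simp add: loc_unit_def loc_int_mult)

lemma loc_unit_power: "prime p \<Longrightarrow> loc_unit p x \<Longrightarrow> loc_unit p (x ^ k)"
proof (induction k)
  case 0
  then show ?case using loc_int_of_int[of p 1] by (simp add: loc_unit_def)
qed (simp add: loc_unit_mult)

lemma loc_unit_of_mult:
  assumes "prime p" "loc_unit p (x * y)" "loc_int p x" "loc_int p y"
  shows "loc_unit p x"
proof -
  have "inverse x = y * inverse (x * y)" using assms(2) by (auto simp: loc_unit_def field_simps)
  then show ?thesis using assms by (metis loc_int_mult loc_unit_def mult_zero_left)
qed

lemma loc_unit_iff:
  assumes "prime p"
  shows "loc_unit p y \<longleftrightarrow> (\<exists>u v. \<not> p dvd u \<and> \<not> p dvd v \<and> y = of_int u / of_int v)"
proof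
  assume y: "loc_unit p y"
  then obtain u v where u: "\<not> p dvd v" "y = of_int u / of_int v" by (auto simp: loc_unit_def loc_int_def)
  obtain u' v' where u': "\<not> p dvd v'" "inverse y = of_int u' / of_int v'"
    using y by (auto simp: loc_unit_def loc_int_def)
  have nz: "v \<noteq> 0" "v' \<noteq> 0" using u(1) u'(1) by auto
  have "y * inverse y = 1" using y by (simp add: loc_unit_def)
  then have "(of_int (u * u') :: rat) = of_int (v * v')"
    using nz unfolding u(2) u'(2)[unfolded u(2)] by (simp add: field_simps)
  then have "u * u' = v * v'" by (simp only: of_int_eq_iff)
  then have "\<not> p dvd u" using u(1) u'(1) assms by (metis dvd_mult2 prime_dvd_mult_iff)
  then show "\<exists>u v. \<not> p dvd u \<and> \<not> p dvd v \<and> y = of_int u / of_int v" using u by blast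
next
  assume "\<exists>u v. \<not> p dvd u \<and> \<not> p dvd v \<and> y = of_int u / of_int v"
  then obtain u v where u: "\<not> p dvd u" "\<not> p dvd v" "y = of_int u / of_int v" by blast
  then have "u \<noteq> 0" "v \<noteq> 0" by auto
  moreover have "inverse y = of_int v / of_int u" using u(3) by simp
  ultimately show "loc_unit p y" unfolding loc_unit_def loc_int_def using u by auto
qed

lemma loc_unit_of_int_iff:
  assumes "prime p"
  shows "loc_unit p (of_int k) \<longleftrightarrow> \<not> p dvd k"
proof
  assume "loc_unit p (of_int k)"
  then obtain u v where u: "\<not> p dvd u" "\<not> p dvd v" "(of_int k :: rat) = of_int u / of_int v"
    using loc_unit_iff[OF assms] by blast
  then have "v \<noteq> 0" by auto
  then have "(of_int (k * v) :: rat) = of_int u" using u(3) by simp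
  then have "k * v = u" by (simp only: of_int_eq_iff)
  then show "\<not> p dvd k" using u(1) by auto
next
  assume "\<not> p dvd k"
  moreover have "\<not> p dvd 1" using assms by (auto dest: not_prime_unit)
  ultimately show "loc_unit p (of_int k)"
    unfolding loc_unit_iff[OF assms] by (intro exI[of _ k] exI[of _ 1]) simp
qed

lemma loc_unit_add:
  assumes p: "prime p" and "loc_unit p l" "loc_int p s"
  shows "loc_unit p (l + of_int p * s)"
proof -
  obtain u v where u: "\<not> p dvd u" "\<not> p dvd v" "l = of_int u / of_int v"
    using assms(2) loc_unit_iff[OF p] by blast
  obtain u' v' where u': "\<not> p dvd v'" "s = of_int u' / of_int v'" using assms(3) by (auto simp: loc_int_def)
  have nz: "v \<noteq> 0" "v' \<noteq> 0" using u u' by auto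
  have "l + of_int p * s = of_int (u * v' + p * (u' * v)) / of_int (v * v')"
    unfolding u(3) u'(2) using nz by (simp add: field_simps)
  moreover have "\<not> p dvd v * v'" using u(2) u'(1) p by (simp add: prime_dvd_mult_iff)
  moreover have "\<not> p dvd u * v' + p * (u' * v)"
    using u(1) u'(1) p by (simp add: prime_dvd_mult_iff dvd_add_left_iff)
  ultimately show ?thesis unfolding loc_unit_iff[OF p] by blast
qed

lemma rat_lowest_terms:
  fixes x :: rat
  obtains a b where "quotient_of x = (a, b)" "b > 0" "coprime a b" "x = of_int a / of_int b"
proof -
  obtain a b where "quotient_of x = (a, b)" by force
  then show ?thesis
    using that quotient_of_denom_pos quotient_of_coprime quotient_of_div by blast
qed

lemma not_loc_intE:
  assumes p: "prime p" and "\<not> loc_int p x"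
  obtains z where "loc_int p z" "x \<noteq> 0" "inverse x = of_int p * z"
proof -
  obtain a b where ab: "b > 0" "coprime a b" "x = of_int a / of_int b" using rat_lowest_terms by blast
  have "p dvd b" using assms(2) ab(3) by (auto simp: loc_int_def)
  then obtain c where c: "b = p * c" by blast
  have "\<not> p dvd a" using \<open>p dvd b\<close> ab(2) p by (meson coprime_common_divisor not_prime_unit)
  then have "loc_int p (of_int c / of_int a)" by (auto simp: loc_int_def)
  moreover have "a \<noteq> 0" using \<open>\<not> p dvd a\<close> by auto
  ultimately show ?thesis using ab c by (intro that[of "of_int c / of_int a"]) auto
qed

text \<open>The primes with nonzero valuation, whether in the numerator or in the denominator. Zero
  is a unit at no prime, so \<open>supp 0\<close> consists of all primes; this is why finiteness
  asks for a nonzero argument.\<close>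

definition supp :: "rat \<Rightarrow> int set" where
  "supp y = {p. prime p \<and> \<not> loc_unit p y}"

lemma supp_subset_prime_factors:
  assumes "y = of_int u / of_int v" "u \<noteq> 0" "v \<noteq> 0"
  shows "supp y \<subseteq> prime_factors (u * v)"
proof
  fix p assume "p \<in> supp y"
  then have p: "prime p" "\<not> loc_unit p y" by (auto simp: supp_def)
  then have "p dvd u \<or> p dvd v" using loc_unit_iff[OF p(1)] assms(1) by blast
  then show "p \<in> prime_factors (u * v)" using p(1) assms by (auto simp: prime_factors_dvd)
qed

lemma finite_supp: 
  assumes "y \<noteq> 0" shows "finite (supp y)"
proof -
  obtain a b where ab: "b > 0" "coprime a b" "y = of_int a / of_int b" using rat_lowest_terms by blast
  then show ?thesis using supp_subset_prime_factors[OF ab(3)] assms by (auto intro: finite_subset)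
qed

definition lrad :: "rat \<Rightarrow> real" where
  "lrad y = (\<Sum>p\<in>supp y. ln (of_int p))"

lemma ln_prime_nonneg: "prime (p::int) \<Longrightarrow> 0 \<le> ln (real_of_int p)"
  using prime_ge_1_int by simp

lemma lrad_nonneg: "lrad y \<ge> 0"
  unfolding lrad_def by (intro sum_nonneg ln_prime_nonneg) (simp add: supp_def)

lemma lrad_le:
  assumes "supp y \<subseteq> A \<union> B" "finite A" "finite B" "\<And>p. p \<in> A \<union> B \<Longrightarrow> prime p"
  shows "lrad y \<le> (\<Sum>p\<in>A. ln (of_int p)) + (\<Sum>p\<in>B. ln (of_int p))"
proof -
  have nn: "0 \<le> ln (real_of_int p)" if "p \<in> A \<union> B" for p
    using ln_prime_nonneg[OF assms(4)[OF that]] .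
  have "lrad y \<le> (\<Sum>p\<in>A \<union> B. ln (of_int p))"
    unfolding lrad_def using assms nn by (intro sum_mono2) auto
  also have "\<dots> \<le> (\<Sum>p\<in>A. ln (of_int p)) + (\<Sum>p\<in>B. ln (of_int p))"
    using assms(2,3) nn sum_nonneg[of "A \<inter> B" "\<lambda>p. ln (real_of_int p)"] by (simp add: sum_Un)
  finally show ?thesis .
qed

lemma ln_rad: "ln (real_of_int (rad n)) = (\<Sum>p\<in>prime_factors n. ln (real_of_int p))"
proof -
  have "real_of_int p > 0" if "p \<in> prime_factors n" for p
    using that prime_gt_0_int[of p] by auto
  then have "ln (\<Prod>p\<in>prime_factors n. real_of_int p) = (\<Sum>p\<in>prime_factors n. ln (real_of_int p))"
    by (intro ln_prod) auto
  then show ?thesis by (simp add: rad_def)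
qed

lemma sum_ln_prime_factors_le:
  assumes n: "n \<noteq> 0"
  shows "(\<Sum>p\<in>prime_factors n. ln (real_of_int p)) \<le> ln \<bar>real_of_int n\<bar>"
proof -
  have "rad n dvd (\<Prod>p\<in>prime_factors n. p ^ multiplicity p n)"
    unfolding rad_def
    by (rule prod_dvd_prod) (auto intro!: dvd_power simp: prime_factors_multiplicity)
  then have "rad n dvd n" using prod_prime_factors[OF n] by simp
  then have "rad n \<le> \<bar>n\<bar>" using dvd_imp_le_int[OF n] by force
  moreover have "rad n > 0"
    unfolding rad_def by (intro prod_pos) (use prime_gt_0_int in auto)
  ultimately have "ln (real_of_int (rad n)) \<le> ln \<bar>real_of_int n\<bar>" by (intro ln_mono) linarith+
  then show ?thesis by (simp add: ln_rad)
qed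

section \<open>Values of polynomials at all but finitely many primes\<close>

definition loc_int_poly :: "int \<Rightarrow> rat poly \<Rightarrow> bool" where
  "loc_int_poly p F \<longleftrightarrow> (\<forall>i. loc_int p (coeff F i))"

lemma loc_int_poly_eval:
  assumes p: "prime p" and "loc_int_poly p F" "loc_int p x"
  shows "loc_int p (poly F x)"
  using assms(2)
proof (induction F)
  case 0
  then show ?case using loc_int_of_int[OF p, of 0] by simp
next
  case (pCons c F)
  then have "loc_int p c" "loc_int_poly p F"
    unfolding loc_int_poly_def by (metis coeff_pCons_0, metis coeff_pCons_Suc)
  then show ?case using pCons.IH assms(3) by (simp add: loc_int_add loc_int_mult p)
qed

lemma finite_not_loc_int: "finite {p. prime p \<and> \<not> loc_int p y}"
proof (cases "y = 0")
  case True
  then show ?thesis using loc_int_of_int[of _ 0] by (auto intro: finite_subset[of _ "{}"])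
next
  case False
  then show ?thesis using finite_supp[OF False]
    by (auto simp: supp_def loc_unit_def intro: finite_subset[rotated])
qed

lemma finite_not_loc_int_poly: "finite {p. prime p \<and> \<not> loc_int_poly p F}"
proof (rule finite_subset)
  show "finite (\<Union>i\<le>degree F. {p. prime p \<and> \<not> loc_int p (coeff F i)})"
    using finite_not_loc_int by auto
  show "{p. prime p \<and> \<not> loc_int_poly p F} \<subseteq> (\<Union>i\<le>degree F. {p. prime p \<and> \<not> loc_int p (coeff F i)})"
  proof
    fix p assume "p \<in> {p. prime p \<and> \<not> loc_int_poly p F}"
    then obtain i where i: "prime p" "\<not> loc_int p (coeff F i)" by (auto simp: loc_int_poly_def)
    then have "coeff F i \<noteq> 0" using loc_int_of_int[OF i(1), of 0] by auto
    then have "i \<le> degree F" by (rule le_degree)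
    then show "p \<in> (\<Union>i\<le>degree F. {p. prime p \<and> \<not> loc_int p (coeff F i)})" using i by auto
  qed
qed

text \<open>With w = 1 / x, divisible by \<open>p\<close>, the reversed polynomial gives
  \<open>w ^ degree G * poly G x\<close> \<equiv> \<open>lead_coeff G\<close> modulo
  \<open>p\<close>, a unit. Were \<open>poly G x\<close> a unit too, the positive power of w would
  make the product divisible by \<open>p\<close>. This is how \<open>lrad (poly G x)\<close>
  registers the primes where x meets \<infinity>.\<close>

lemma not_loc_unit_poly_at_pole:
  assumes p: "prime p" and G: "loc_int_poly p G" "loc_unit p (lead_coeff G)" "degree G > 0"
    and x: "\<not> loc_int p x"
  shows "\<not> loc_unit p (poly G x)"
proof
  assume u: "loc_unit p (poly G x)"
  obtain z where z: "loc_int p z" "x \<noteq> 0" "inverse x = of_int p * z" using not_loc_intE[OF p x] .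
  define w where "w = inverse x"
  have w: "w \<noteq> 0" "inverse w = x" using z(2) by (auto simp: w_def)
  have lw: "loc_int p w" unfolding w_def z(3) using z(1) by (simp add: loc_int_mult loc_int_of_int p)
  obtain c H where H: "reflect_poly G = pCons c H" by (cases "reflect_poly G") auto
  have c: "c = lead_coeff G" using arg_cong[OF H, of "\<lambda>q. coeff q 0"] by simp
  have "loc_int p (coeff (reflect_poly G) i)" for i
    using G(1) loc_int_of_int[OF p, of 0] by (auto simp: coeff_reflect_poly loc_int_poly_def)
  then have "loc_int_poly p H" unfolding loc_int_poly_def H by (metis coeff_pCons_Suc)
  then have lH: "loc_int p (poly H w)" using lw by (intro loc_int_poly_eval p)
  have "w ^ degree G * poly G x = poly (reflect_poly G) w"
    using poly_reflect_poly_nz[OF w(1), of G] w(2) by simp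
  also have "\<dots> = lead_coeff G + of_int p * (z * poly H w)"
    unfolding H c using z(3) by (simp add: w_def)
  finally have "loc_unit p (w ^ degree G * poly G x)"
    using loc_unit_add[OF p G(2)] z(1) lH by (simp add: loc_int_mult p)
  moreover have "loc_int p (w ^ k)" for k
    using lw loc_int_of_int[OF p, of 1] by (induction k) (simp_all add: loc_int_mult p)
  moreover from this have "loc_int p (w ^ (degree G - 1) * poly G x)"
    using u p by (simp add: loc_int_mult loc_unit_def)
  moreover have "w ^ degree G * poly G x = of_int p * (z * (w ^ (degree G - 1) * poly G x))"
    using G(3) z(3) by (simp add: w_def power_eq_if)
  ultimately have "loc_unit p (of_int p)"
    using z(1) p by (metis loc_int_mult loc_int_of_int loc_unit_of_mult)
  then show False using loc_unit_of_int_iff[OF p] by simp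
qed

text \<open>Write \<open>G ^ k = F * H\<close>. Outside the bad primes, a unit value of
  \<open>G\<close> forces x to be integral at the prime by the preceding lemma; then
  \<open>F\<close> and \<open>H\<close> have integral values whose product is a unit, so both values
  are units. The bad primes depend on the polynomials only, not on x.\<close>

lemma supp_poly_subset:
  assumes dvd: "F dvd G ^ k" and G: "degree G > 0"
  obtains B where "finite B" "\<And>p. p \<in> B \<Longrightarrow> prime p"
    "\<And>x. poly G x \<noteq> 0 \<Longrightarrow> supp (poly F x) \<subseteq> supp (poly G x) \<union> B"
proof -
  obtain H where H: "G ^ k = F * H" using dvd by blast
  define B where "B = {p. prime p \<and> \<not> loc_int_poly p F} \<union> {p. prime p \<and> \<not> loc_int_poly p G}
     \<union> {p. prime p \<and> \<not> loc_int_poly p H} \<union> supp (lead_coeff G)"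
  have "lead_coeff G \<noteq> 0" using G by auto
  then have "finite B" unfolding B_def by (intro finite_UnI finite_not_loc_int_poly finite_supp)
  moreover have "p \<in> supp (poly G x) \<union> B" if p: "p \<in> supp (poly F x)" for p x
  proof (rule ccontr)
    assume n: "p \<notin> supp (poly G x) \<union> B"
    have pp: "prime p" "\<not> loc_unit p (poly F x)" using p by (auto simp: supp_def)
    have good: "loc_int_poly p F" "loc_int_poly p G" "loc_int_poly p H" "loc_unit p (lead_coeff G)"
      "loc_unit p (poly G x)"
      using n pp by (auto simp: B_def supp_def)
    then have x: "loc_int p x" using not_loc_unit_poly_at_pole[OF pp(1)] G by blast
    have "poly F x * poly H x = poly G x ^ k" using arg_cong[OF H, of "\<lambda>q. poly q x"] by simp
    then have "loc_unit p (poly F x * poly H x)" using good pp by (simp add: loc_unit_power)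
    then show False
      using loc_unit_of_mult[OF pp(1)] pp(2) loc_int_poly_eval[OF pp(1) _ x] good by blast
  qed
  ultimately show ?thesis by (intro that[of B]) (auto simp: B_def supp_def)
qed


section \<open>Heights\<close>

definition height :: "rat \<Rightarrow> real" where
  "height x = ln (real_of_int (max \<bar>fst (quotient_of x)\<bar> (snd (quotient_of x))))"

lemma height_lowest_terms:
  obtains a b where "b > 0" "coprime a b" "x = of_int a / of_int b"
    "height x = ln (real_of_int (max \<bar>a\<bar> b))"
proof -
  obtain a b where "quotient_of x = (a, b)" "b > 0" "coprime a b" "x = of_int a / of_int b"
    using rat_lowest_terms[of x] .
  then show ?thesis using that[of b a] by (simp add: height_def)
qed

lemma height_eq:
  assumes "b > 0" "coprime a b"
  shows "height (of_int a / of_int b) = ln (real_of_int (max \<bar>a\<bar> b))"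
proof -
  have "quotient_of (of_int a / of_int b) = (a, b)"
    using assms by (simp add: Rat.Fract_of_int_quotient[symmetric] quotient_of_Fract Rat.normalize_stable)
  then show ?thesis by (simp add: height_def)
qed

lemma height_nonneg: "height x \<ge> 0"
proof -
  obtain a b where "b > 0" "height x = ln (real_of_int (max \<bar>a\<bar> b))" using height_lowest_terms[of x] .
  then show ?thesis by simp
qed

text \<open>Horner's scheme: the binary form belonging to \<open>T\<close>, scaled by a common
  denominator k of the coefficients, is integral and grows like the t-th power of the larger
  variable. Allowing t to exceed the degree lets the same bound serve the lower-order part of a
  polynomial.\<close>

lemma homogenization:
  fixes T :: "rat poly"
  assumes "degree T \<le> t"
  shows "\<exists>k>0. \<exists>C>0. \<forall>a b. b > 0 \<longrightarrow> (\<exists>N. of_int N = of_int k * of_int b ^ t * poly T (of_int a / of_int b)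
           \<and> \<bar>real_of_int N\<bar> \<le> C * real_of_int (max \<bar>a\<bar> b) ^ t)"
  using assms
proof (induction T arbitrary: t)
  case 0
  have "\<forall>a b. b > 0 \<longrightarrow> (\<exists>N. of_int N = of_int 1 * of_int b ^ t * poly 0 (of_int a / of_int b :: rat)
           \<and> \<bar>real_of_int N\<bar> \<le> 1 * real_of_int (max \<bar>a\<bar> b) ^ t)"
    by (auto intro!: exI[of _ 0])
  then show ?case by (intro exI[of _ "1::int"] exI[of _ "1::real"] conjI) simp_all
next
  case (pCons c T)
  obtain r s where rs: "s > 0" "coprime r s" "c = of_int r / of_int s" using rat_lowest_terms by blast
  show ?case
  proof (cases "T = 0")
    case True
    have "\<bar>real_of_int (r * b ^ t)\<bar> \<le> (\<bar>real_of_int r\<bar> + 1) * real_of_int (max \<bar>a\<bar> b) ^ t"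
      if "b > 0" for a b
    proof -
      have "real_of_int b ^ t \<le> real_of_int (max \<bar>a\<bar> b) ^ t" using that by (intro power_mono) auto
      then have "\<bar>real_of_int r\<bar> * real_of_int b ^ t \<le> (\<bar>real_of_int r\<bar> + 1) * real_of_int (max \<bar>a\<bar> b) ^ t"
        using that by (intro mult_mono) auto
      then show ?thesis using that by (simp add: abs_mult)
    qed
    moreover have "of_int (r * b ^ t) = of_int s * of_int b ^ t * poly (pCons c T) (of_int a / of_int b)"
      for a b using rs True by simp
    ultimately have "\<forall>a b. b > 0 \<longrightarrow>
        (\<exists>N. of_int N = of_int s * of_int b ^ t * poly (pCons c T) (of_int a / of_int b)
           \<and> \<bar>real_of_int N\<bar> \<le> (\<bar>real_of_int r\<bar> + 1) * real_of_int (max \<bar>a\<bar> b) ^ t)" by blast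
    moreover have "\<bar>real_of_int r\<bar> + 1 > 0" by linarith
    ultimately show ?thesis using rs(1) by blast
  next
    case False
    then obtain t' where t: "t = Suc t'" "degree T \<le> t'" using pCons.prems by (cases t) auto
    obtain k C where kC: "k > 0" "C > 0" "\<forall>a b. b > 0 \<longrightarrow> (\<exists>N. of_int N = of_int k * of_int b ^ t' * poly T (of_int a / of_int b)
           \<and> \<bar>real_of_int N\<bar> \<le> C * real_of_int (max \<bar>a\<bar> b) ^ t')"
      using pCons.IH[OF t(2)] by auto
    define C' where "C' = \<bar>real_of_int r\<bar> * k + s * C"
    have "\<exists>N. of_int N = of_int (s * k) * of_int b ^ t * poly (pCons c T) (of_int a / of_int b)
           \<and> \<bar>real_of_int N\<bar> \<le> C' * real_of_int (max \<bar>a\<bar> b) ^ t" if b: "b > 0" for a b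
    proof -
      obtain N where N: "of_int N = of_int k * of_int b ^ t' * poly T (of_int a / of_int b)"
           "\<bar>real_of_int N\<bar> \<le> C * real_of_int (max \<bar>a\<bar> b) ^ t'" using kC(3) b by blast
      define H where "H = real_of_int (max \<bar>a\<bar> b)"
      have H: "\<bar>real_of_int a\<bar> \<le> H" "real_of_int b \<le> H" "0 \<le> H" using b by (auto simp: H_def)
      have "of_int (r * k * b ^ t + s * (a * N))
          = of_int (s * k) * of_int b ^ t * poly (pCons c T) (of_int a / of_int b)"
        using rs b by (simp add: N(1) t(1) field_simps)
      moreover have "\<bar>real_of_int (r * k * b ^ t + s * (a * N))\<bar> \<le> C' * H ^ t"
      proof -
        have "\<bar>real_of_int (r * k * b ^ t + s * (a * N))\<bar>
            \<le> \<bar>real_of_int r\<bar> * k * real_of_int b ^ t + s * (\<bar>real_of_int a\<bar> * \<bar>real_of_int N\<bar>)"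
          using kC(1) rs(1) b abs_triangle_ineq[of "real_of_int (r * k * b ^ t)" "real_of_int (s * (a * N))"]
          by (simp add: abs_mult)
        moreover have "\<bar>real_of_int r\<bar> * k * real_of_int b ^ t \<le> \<bar>real_of_int r\<bar> * k * H ^ t"
          using H b kC(1) by (intro mult_left_mono power_mono) auto
        moreover have "s * (\<bar>real_of_int a\<bar> * \<bar>real_of_int N\<bar>) \<le> s * (H * (C * H ^ t'))"
          using H N(2) rs(1) unfolding H_def[symmetric] by (intro mult_left_mono mult_mono) auto
        moreover have "\<bar>real_of_int r\<bar> * k * H ^ t + s * (H * (C * H ^ t')) = C' * H ^ t"
          by (simp add: C'_def t(1) algebra_simps)
        ultimately show ?thesis by linarith
      qed
      ultimately show ?thesis unfolding H_def[symmetric] by blast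
    qed
    moreover have "s * k > 0" "C' > 0" using rs(1) kC by (auto simp: C'_def intro: add_nonneg_pos)
    ultimately show ?thesis by blast
  qed
qed

text \<open>Split off the leading term and put the value over the denominator
  \<open>K * b ^ n\<close>. Two things have to be bounded: how much this fraction can cancel, and
  how small its numerator and denominator can be at the same time.\<close>

lemma height_poly_ge:
  assumes n: "degree \<Phi> > 0"
  obtains C where "\<And>x. real (degree \<Phi>) * height x - C \<le> height (poly \<Phi> x)"
proof -
  define n where "n = degree \<Phi>"
  define \<Psi> where "\<Psi> = \<Phi> - monom (lead_coeff \<Phi>) n"
  have "degree \<Psi> \<le> n - 1"
    by (rule degree_le) (auto simp: \<Psi>_def n_def coeff_eq_0 dest!: leD)
  then obtain k C where kC: "k > 0" "C > 0" "\<forall>a b. b > 0 \<longrightarrow> (\<exists>N. of_int N = of_int k * of_int b ^ (n - 1) * poly \<Psi> (of_int a / of_int b)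
           \<and> \<bar>real_of_int N\<bar> \<le> C * real_of_int (max \<bar>a\<bar> b) ^ (n - 1))"
    using homogenization by blast
  obtain r s where rs: "s > 0" "coprime r s" "lead_coeff \<Phi> = of_int r / of_int s" using rat_lowest_terms by blast
  have "r \<noteq> 0" using rs(3) n by auto
  define K where "K = k * s"
  define L where "L = k * r"
  have KL: "K > 0" "L \<noteq> 0" using kC(1) rs(1) \<open>r \<noteq> 0\<close> by (auto simp: K_def L_def)
  \<comment> \<open>If \<open>D * b\<close> is below the maximum \<open>H\<close> of \<bar>a\<bar>
    and b, the lower-order part of the numerator is at most half of \<open>H ^ n\<close>, hence at
    most half of the leading term.\<close>
  define D where "D = 2 * real_of_int s * C + 1"
  define c where "c = min (1 / 2) (1 / D ^ n)"
  define G where "G = real_of_int \<bar>K * L ^ n\<bar>"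
  have D: "D > 1" using kC(2) rs(1) by (simp add: D_def)
  have c: "c > 0" using D by (simp add: c_def)
  have G: "G > 0" using KL by (simp add: G_def)
  have "real n * height x - (- ln (c / G)) \<le> height (poly \<Phi> x)" for x
  proof -
    obtain a b where ab: "b > 0" "coprime a b" "x = of_int a / of_int b"
      "height x = ln (real_of_int (max \<bar>a\<bar> b))" using height_lowest_terms[of x] .
    obtain A B where AB: "B > 0" "coprime A B" "poly \<Phi> x = of_int A / of_int B"
      "height (poly \<Phi> x) = ln (real_of_int (max \<bar>A\<bar> B))" using height_lowest_terms[of "poly \<Phi> x"] .
    obtain N' where N': "of_int N' = of_int k * of_int b ^ (n - 1) * poly \<Psi> x"
       "\<bar>real_of_int N'\<bar> \<le> C * real_of_int (max \<bar>a\<bar> b) ^ (n - 1)" using kC(3) ab by blast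
    define H where "H = real_of_int (max \<bar>a\<bar> b)"
    have H: "\<bar>real_of_int a\<bar> \<le> H" "real_of_int b \<le> H" "1 \<le> H" using ab(1) by (auto simp: H_def)
    define N where "N = L * a ^ n + s * (b * N')"
    have bn: "b ^ n = b * b ^ (n - 1)" using n by (simp add: n_def power_eq_if)
    have "poly \<Phi> x = lead_coeff \<Phi> * x ^ n + poly \<Psi> x" by (simp add: \<Psi>_def poly_monom)
    then have "of_int K * of_int (b ^ n) * poly \<Phi> x
        = of_int K * of_int (b ^ n) * (lead_coeff \<Phi> * x ^ n) + of_int K * of_int (b ^ n) * poly \<Psi> x"
      by (simp add: algebra_simps)
    also have "of_int K * of_int (b ^ n) * (lead_coeff \<Phi> * x ^ n) = of_int (L * a ^ n)"
      using ab(1) rs(1) by (simp add: rs(3) ab(3) K_def L_def field_simps)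
    also have "of_int K * of_int (b ^ n) * poly \<Psi> x = of_int (s * (b * N'))"
      by (simp add: N'(1) K_def bn)
    finally have "of_int K * of_int (b ^ n) * poly \<Phi> x = of_int N" by (simp add: N_def)
    then have "(of_int (N * B) :: rat) = of_int (A * (K * b ^ n))"
      using AB(1) unfolding AB(3) by (simp add: field_simps)
    then have NB: "N * B = A * (K * b ^ n)" by (simp only: of_int_eq_iff)
    then have "B dvd A * (K * b ^ n)" by (metis dvd_triv_right)
    then have "B dvd K * b ^ n" using AB(2) by (simp add: coprime_dvd_mult_right_iff coprime_commute)
    then obtain g where g: "K * b ^ n = B * g" by blast
    have gN: "N = A * g" using NB g AB(1) by simp
    have "B * g > 0" unfolding g[symmetric] using KL(1) ab(1) by simp
    then have g0: "g > 0" using AB(1) by (simp add: zero_less_mult_iff)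
    \<comment> \<open>The cancelled factor \<open>g\<close> divides both \<open>N\<close> and
      \<open>K * b ^ n\<close>. What it shares with \<open>b\<close> divides
      \<open>L * a ^ n\<close> but is coprime to \<open>a\<close>; hence \<open>g\<close> divides
      \<open>K * L ^ n\<close>, a bound independent of x.\<close>
    have e: "gcd g b dvd L"
    proof -
      have "gcd g b dvd N" "gcd g b dvd s * (b * N')" using gN by auto
      then have "gcd g b dvd L * a ^ n" unfolding N_def by (simp add: dvd_add_left_iff)
      moreover have "coprime (gcd g b) (a ^ n)"
        using ab(2) by (meson coprime_commute coprime_divisors coprime_power_right_iff dvd_refl gcd_dvd2)
      ultimately show ?thesis by (simp add: coprime_dvd_mult_left_iff)
    qed
    have "g dvd K * g ^ n" using n by (simp add: n_def dvd_power)
    moreover have "g dvd K * b ^ n" using g by simp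
    ultimately have "g dvd gcd (K * g ^ n) (K * b ^ n)" by (rule gcd_greatest)
    also have "\<dots> dvd K * gcd g b ^ n"
      unfolding gcd_mult_left gcd_exp by simp
    also have "\<dots> dvd K * L ^ n" using e by (intro mult_dvd_mono dvd_power_same) auto
    finally have "g \<le> \<bar>K * L ^ n\<bar>" using KL by (intro zdvd_imp_le) auto
    then have gG: "real_of_int g \<le> G" unfolding G_def by (simp only: of_int_le_iff)
    \<comment> \<open>Either \<open>b\<close> is comparable to \<open>H\<close>, and the denominator
      is large, or \<open>a\<close> dominates, and the leading term makes the numerator
      large.\<close>
    have low: "c * H ^ n \<le> max \<bar>real_of_int N\<bar> (real_of_int (K * b ^ n))"
    proof (cases "H \<le> D * b")
      case True
      have "H ^ n \<le> (D * b) ^ n" using True H by (intro power_mono) auto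
      then have "H ^ n / D ^ n \<le> real_of_int b ^ n" using D by (simp add: field_simps power_mult_distrib)
      moreover have "c * H ^ n \<le> H ^ n / D ^ n"
        using mult_right_mono[of c "1 / D ^ n" "H ^ n"] H by (simp add: c_def)
      moreover have "real_of_int b ^ n \<le> real_of_int (K * b ^ n)"
        using KL(1) ab(1) mult_right_mono[of 1 "real_of_int K" "real_of_int b ^ n"] by simp
      ultimately show ?thesis by linarith
    next
      case False
      have "real_of_int b \<le> D * b" using D ab(1) by simp
      with False have Ha: "H = \<bar>real_of_int a\<bar>" by (auto simp: H_def)
      have Hn: "H ^ n = H * H ^ (n - 1)" using n by (simp add: n_def power_eq_if)
      have "\<bar>real_of_int (s * (b * N'))\<bar> = s * (b * \<bar>real_of_int N'\<bar>)"
        using rs(1) ab(1) by (simp add: abs_mult)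
      also have "\<dots> \<le> s * (b * (C * H ^ (n - 1)))"
        using N'(2) rs(1) ab(1) by (intro mult_left_mono) (auto simp: H_def)
      also have "\<dots> = (s * C * b) * H ^ (n - 1)" by simp
      also have "\<dots> \<le> (H / 2) * H ^ (n - 1)"
      proof (rule mult_right_mono)
        have "2 * (s * C * b) \<le> D * b" using ab(1) by (simp add: D_def algebra_simps)
        then show "s * C * b \<le> H / 2" using False by linarith
      qed (use H in simp)
      finally have t: "\<bar>real_of_int (s * (b * N'))\<bar> \<le> H ^ n / 2" by (simp add: Hn)
      have "1 * H ^ n \<le> \<bar>real_of_int L\<bar> * H ^ n"
        using KL(2) H by (intro mult_right_mono) (linarith, simp)
      then have "H ^ n \<le> \<bar>real_of_int (L * a ^ n)\<bar>" by (simp add: abs_mult Ha power_abs)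
      then have "H ^ n / 2 \<le> \<bar>real_of_int N\<bar>" using t unfolding N_def of_int_add by linarith
      moreover have "c * H ^ n \<le> H ^ n / 2"
        using mult_right_mono[of c "1 / 2" "H ^ n"] H by (simp add: c_def)
      ultimately show ?thesis by linarith
    qed
    also have "max \<bar>real_of_int N\<bar> (real_of_int (K * b ^ n)) = g * real_of_int (max \<bar>A\<bar> B)"
      unfolding gN g of_int_max using g0 by (auto simp: abs_mult max_def mult.commute)
    also have "\<dots> \<le> G * real_of_int (max \<bar>A\<bar> B)" using gG AB(1) by (intro mult_right_mono) auto
    finally have "c / G * H ^ n \<le> real_of_int (max \<bar>A\<bar> B)" using G by (simp add: field_simps)
    then have "ln (c / G * H ^ n) \<le> height (poly \<Phi> x)"
      unfolding AB(4) using c G H by (intro ln_mono) auto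
    moreover have "ln (c / G * H ^ n) = ln (c / G) + n * height x"
      using c G H ab(4) by (subst ln_mult) (auto simp: H_def ln_realpow)
    ultimately show ?thesis by simp
  qed
  then show ?thesis using that unfolding n_def by blast
qed

section \<open>The truncated Vojta inequality on the line\<close>

text \<open>Up to finitely many primes, \<^term>\<open>lrad (poly S x)\<close> also counts the primes in the
  denominator of \<open>x\<close>, i.e. those where \<open>x\<close> meets \<open>\<infinity>\<close>.\<close>

definition vojta :: "rat poly \<Rightarrow> bool" where
  "vojta S \<longleftrightarrow> (\<forall>\<epsilon>>0. \<exists>C. \<forall>x. poly S x \<noteq> 0 \<longrightarrow>
     (real (degree S) - 1 - \<epsilon>) * height x \<le> lrad (poly S x) + C)"

lemma vojtaI:
  assumes "\<And>\<epsilon>. \<epsilon> > 0 \<Longrightarrow> \<exists>C. \<forall>x. poly S x \<noteq> 0 \<longrightarrow>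
     (real (degree S) - 1 - \<epsilon>) * height x \<le> lrad (poly S x) + C"
  shows "vojta S"
  using assms unfolding vojta_def by blast

lemma vojtaE:
  assumes "vojta S" "\<epsilon> > 0"
  obtains C where "C \<ge> 0" "\<And>x. poly S x \<noteq> 0 \<Longrightarrow>
     (real (degree S) - 1 - \<epsilon>) * height x \<le> lrad (poly S x) + C"
proof -
  obtain C where "\<And>x. poly S x \<noteq> 0 \<Longrightarrow> (real (degree S) - 1 - \<epsilon>) * height x \<le> lrad (poly S x) + C"
    using assms unfolding vojta_def by blast
  then show ?thesis by (intro that[of "max C 0"]) fastforce+
qed

text \<open>The degree condition says that \<open>\<Phi>\<close> has no finite critical values outside the roots of
  \<open>S\<close>, when \<open>S'\<close> is the squarefree part of \<open>S \<circ> \<Phi>\<close>.\<close>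

lemma vojta_pullback:
  assumes S: "vojta S" "degree S > 0" and \<Phi>: "degree \<Phi> > 0"
    and dvd: "pcompose S \<Phi> dvd S' ^ k" and deg: "degree S' = degree \<Phi> * (degree S - 1) + 1"
  shows "vojta S'"
proof (rule vojtaI)
  fix \<epsilon> :: real assume \<epsilon>: "\<epsilon> > 0"
  define n where "n = real (degree \<Phi>)"
  have n: "n > 0" using \<Phi> by (simp add: n_def)
  \<comment> \<open>The map multiplies heights by \<open>n\<close>, so the permitted loss is divided
    by \<open>n\<close> beforehand.\<close>
  obtain C where C: "C \<ge> 0" "\<And>y. poly S y \<noteq> 0 \<Longrightarrow>
     (real (degree S) - 1 - \<epsilon> / n) * height y \<le> lrad (poly S y) + C"
    using vojtaE[OF S(1), of "\<epsilon> / n"] \<epsilon> n by auto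
  obtain D where D: "\<And>x. n * height x - D \<le> height (poly \<Phi> x)"
    using height_poly_ge[OF \<Phi>] unfolding n_def by blast
  obtain B where B: "finite B" "\<And>p. p \<in> B \<Longrightarrow> prime p"
    "\<And>x. poly S' x \<noteq> 0 \<Longrightarrow> supp (poly (pcompose S \<Phi>) x) \<subseteq> supp (poly S' x) \<union> B"
    using supp_poly_subset[OF dvd] deg by auto
  define c where "c = real (degree S) - 1 - \<epsilon> / n"
  have nc: "real (degree S') - 1 - \<epsilon> = n * c"
    using S(2) n deg by (simp add: n_def c_def of_nat_diff algebra_simps)
  have "(real (degree S') - 1 - \<epsilon>) * height x
      \<le> lrad (poly S' x) + (\<bar>c * D\<bar> + C + (\<Sum>p\<in>B. ln (of_int p)))" if x: "poly S' x \<noteq> 0" for x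
  \<comment> \<open>The lower bound for the height of the image can be multiplied by
    \<open>c\<close> only if \<open>c\<close> is nonnegative; otherwise the left side is at most 0
    and the claim is trivial.\<close>
  proof (cases "c \<ge> 0")
    case False
    then have "n * c * height x \<le> 0" using n height_nonneg[of x] by (simp add: mult_le_0_iff)
    moreover have "0 \<le> (\<Sum>p\<in>B. ln (real_of_int p))" using B(2) by (intro sum_nonneg ln_prime_nonneg)
    ultimately show ?thesis unfolding nc using lrad_nonneg[of "poly S' x"] C(1) by linarith
  next
    case True
    have nz: "poly S (poly \<Phi> x) \<noteq> 0"
    proof -
      obtain H where "S' ^ k = pcompose S \<Phi> * H" using dvd by blast
      then have "poly S' x ^ k = poly S (poly \<Phi> x) * poly H x"
        by (metis poly_mult poly_pcompose poly_power)
      then show ?thesis using x by auto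
    qed
    have "c * (n * height x - D) \<le> c * height (poly \<Phi> x)" using True D by (intro mult_left_mono)
    also have "\<dots> \<le> lrad (poly S (poly \<Phi> x)) + C" using C(2)[OF nz] by (simp add: c_def)
    also have "lrad (poly S (poly \<Phi> x)) \<le> lrad (poly S' x) + (\<Sum>p\<in>B. ln (of_int p))"
      unfolding lrad_def[of "poly S' x"]
    proof (rule lrad_le)
      show "supp (poly S (poly \<Phi> x)) \<subseteq> supp (poly S' x) \<union> B" using B(3)[OF x] by (simp add: poly_pcompose)
      show "prime p" if "p \<in> supp (poly S' x) \<union> B" for p using that B(2) by (auto simp: supp_def)
    qed (use B(1) finite_supp[OF x] in auto)
    finally show ?thesis unfolding nc using abs_ge_self[of "c * D"] by (simp add: algebra_simps)
  qed
  then show "\<exists>C. \<forall>x. poly S' x \<noteq> 0 \<longrightarrow> (real (degree S') - 1 - \<epsilon>) * height x \<le> lrad (poly S' x) + C"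
    by blast
qed

text \<open>Primes in the denominator of x are already counted by \<open>S\<close>, which is
  nonconstant. Any further prime contributed by \<open>T\<close> divides, up to finitely many
  exceptions, the homogenized value of \<open>T\<close>, and the radical of that integer is at most
  its absolute value.\<close>

lemma lrad_poly_mult_le:
  assumes S: "degree S > 0"
  obtains C where "\<And>x. poly S x \<noteq> 0 \<Longrightarrow> poly T x \<noteq> 0 \<Longrightarrow>
    lrad (poly (S * T) x) \<le> lrad (poly S x) + real (degree T) * height x + C"
proof -
  obtain k C where kC: "k > 0" "C > 0" "\<forall>a b. b > 0 \<longrightarrow> (\<exists>N. of_int N = of_int k * of_int b ^ degree T * poly T (of_int a / of_int b)
           \<and> \<bar>real_of_int N\<bar> \<le> C * real_of_int (max \<bar>a\<bar> b) ^ degree T)"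
    using homogenization[of T "degree T"] by blast
  define B where "B = {p. prime p \<and> \<not> loc_int_poly p S} \<union> {p. prime p \<and> \<not> loc_int_poly p T}
     \<union> supp (lead_coeff S)"
  have "lead_coeff S \<noteq> 0" using S by auto
  then have B: "finite B" unfolding B_def by (intro finite_UnI finite_not_loc_int_poly finite_supp)
  have Bp: "prime p" if "p \<in> B" for p using that by (auto simp: B_def supp_def)
  have "lrad (poly (S * T) x) \<le> lrad (poly S x) + real (degree T) * height x
      + (ln C + (\<Sum>p\<in>B. ln (of_int p)))"
    if x: "poly S x \<noteq> 0" "poly T x \<noteq> 0" for x
  proof -
    obtain a b where ab: "b > 0" "coprime a b" "x = of_int a / of_int b"
      "height x = ln (real_of_int (max \<bar>a\<bar> b))" using height_lowest_terms[of x] .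
    obtain N where N: "of_int N = of_int k * of_int b ^ degree T * poly T x"
      "\<bar>real_of_int N\<bar> \<le> C * real_of_int (max \<bar>a\<bar> b) ^ degree T" using kC(3) ab by blast
    have N0: "N \<noteq> 0" using N(1) kC(1) ab(1) x(2) by auto
    have "supp (poly (S * T) x) \<subseteq> (supp (poly S x) \<union> prime_factors N) \<union> B"
    proof (rule subsetI, rule ccontr)
      fix p assume p: "p \<in> supp (poly (S * T) x)" "p \<notin> (supp (poly S x) \<union> prime_factors N) \<union> B"
      then have pp: "prime p" "\<not> loc_unit p (poly S x * poly T x)" by (auto simp: supp_def)
      have good: "loc_int_poly p S" "loc_int_poly p T" "loc_unit p (lead_coeff S)" "loc_unit p (poly S x)"
        "\<not> p dvd N"
        using p pp(1) N0 by (auto simp: B_def supp_def prime_factors_dvd)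
      then have "loc_int p x" using not_loc_unit_poly_at_pole[OF pp(1)] S by blast
      then have lT: "loc_int p (poly T x)" using loc_int_poly_eval pp(1) good by blast
      have "of_int N = poly T x * of_int (k * b ^ degree T)" using N(1) by (simp add: mult_ac)
      then have "loc_unit p (poly T x * of_int (k * b ^ degree T))"
        using good(5) loc_unit_of_int_iff[OF pp(1)] by metis
      then have "loc_unit p (poly T x)" by (rule loc_unit_of_mult[OF pp(1)]) (rule lT, rule loc_int_of_int[OF pp(1)])
      then show False using pp good(4) loc_unit_mult by blast
    qed
    moreover have "finite (supp (poly S x) \<union> prime_factors N)" using finite_supp[OF x(1)] by simp
    ultimately have "lrad (poly (S * T) x)
        \<le> (\<Sum>p\<in>supp (poly S x) \<union> prime_factors N. ln (of_int p)) + (\<Sum>p\<in>B. ln (of_int p))"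
      using B Bp by (intro lrad_le) (auto simp: supp_def)
    also have "(\<Sum>p\<in>supp (poly S x) \<union> prime_factors N. ln (real_of_int p))
        \<le> lrad (poly S x) + (\<Sum>p\<in>prime_factors N. ln (of_int p))"
      unfolding lrad_def
      using finite_supp[OF x(1)] sum_nonneg[of "supp (poly S x) \<inter> prime_factors N" "\<lambda>p. ln (real_of_int p)"]
      by (simp add: sum_Un ln_prime_nonneg supp_def)
    also have "(\<Sum>p\<in>prime_factors N. ln (real_of_int p)) \<le> ln \<bar>real_of_int N\<bar>"
      by (rule sum_ln_prime_factors_le[OF N0])
    also have "\<dots> \<le> ln (C * real_of_int (max \<bar>a\<bar> b) ^ degree T)"
      using N(2) N0 by (intro ln_mono) auto
    also have "\<dots> = ln C + real (degree T) * height x"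
      using kC(2) ab by (subst ln_mult) (auto simp: ln_realpow)
    finally show ?thesis by simp
  qed
  then show ?thesis using that by blast
qed

text \<open>Dropping \<open>T\<close> lowers the coefficient on the left by \<open>degree T\<close>,
  which is exactly what the trivial bound for the primes of \<open>T\<close> costs on the
  right.\<close>

lemma vojta_factor:
  assumes ST: "vojta (S * T)" and S: "degree S > 0" and T: "T \<noteq> 0"
  shows "vojta S"
proof (rule vojtaI)
  fix \<epsilon> :: real assume \<epsilon>: "\<epsilon> > 0"
  obtain C where C: "\<And>x. poly (S * T) x \<noteq> 0 \<Longrightarrow>
     (real (degree (S * T)) - 1 - \<epsilon>) * height x \<le> lrad (poly (S * T) x) + C"
    using vojtaE[OF ST \<epsilon>] by auto
  obtain D where D: "\<And>x. poly S x \<noteq> 0 \<Longrightarrow> poly T x \<noteq> 0 \<Longrightarrow>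
    lrad (poly (S * T) x) \<le> lrad (poly S x) + real (degree T) * height x + D"
    using lrad_poly_mult_le[OF S] by blast
  define c where "c = real (degree S) - 1 - \<epsilon>"
  \<comment> \<open>At the finitely many roots of \<open>T\<close> the inequality for
    \<open>S * T\<close> says nothing; their heights are absorbed into the constant.\<close>
  define M where "M = (\<Sum>x | poly T x = 0. height x)"
  have "c * height x \<le> lrad (poly S x) + (\<bar>C + D\<bar> + \<bar>c\<bar> * M)" if x: "poly S x \<noteq> 0" for x
  proof (cases "poly T x = 0")
    case True
    have "height x \<le> M"
      unfolding M_def using True poly_roots_finite[OF T] by (intro member_le_sum) (auto simp: height_nonneg)
    then have "c * height x \<le> \<bar>c\<bar> * M" using height_nonneg[of x] by (intro mult_mono) auto
    then show ?thesis using lrad_nonneg[of "poly S x"] by linarith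
  next
    case False
    have "S \<noteq> 0" using S by auto
    then have "real (degree (S * T)) - 1 - \<epsilon> = c + real (degree T)"
      using T by (simp add: degree_mult_eq c_def)
    then have "c * height x + real (degree T) * height x
        \<le> lrad (poly S x) + real (degree T) * height x + D + C"
      using C[of x] D[OF x False] x False by (simp add: algebra_simps)
    moreover have "0 \<le> \<bar>c\<bar> * M" unfolding M_def by (intro mult_nonneg_nonneg sum_nonneg) (auto simp: height_nonneg)
    ultimately show ?thesis by linarith
  qed
  then show "\<exists>C. \<forall>x. poly S x \<noteq> 0 \<longrightarrow> (real (degree S) - 1 - \<epsilon>) * height x \<le> lrad (poly S x) + C"
    unfolding c_def by blast
qed

text \<open>For x = a / b in lowest terms the abc inequality is applied to a + (b - a) + (- b) =
  0.\<close>

lemma vojta_zero_one: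
  assumes "uniform_abc_conjecture"
  shows "vojta ([:0, 1:] * [:-1, 1:])"
proof (rule vojtaI)
  fix \<epsilon> :: real assume \<epsilon>: "\<epsilon> > 0"
  let ?S = "[:0, 1:] * [:-1, 1:] :: rat poly"
  obtain C where C: "\<And>a b c :: int. a \<noteq> 0 \<Longrightarrow> b \<noteq> 0 \<Longrightarrow> c \<noteq> 0 \<Longrightarrow> a + b + c = 0 \<Longrightarrow> coprime a b \<Longrightarrow>
    ln (max \<bar>real_of_int a\<bar> (max \<bar>real_of_int b\<bar> \<bar>real_of_int c\<bar>))
      \<le> (1 + \<epsilon>) * (\<Sum>p\<in>prime_factors (a * b * c). ln (real_of_int p)) + C"
    using abc_integers[OF assms \<epsilon>] by blast
  have "(1 - \<epsilon>) * height x \<le> lrad (poly ?S x) + \<bar>C\<bar>" if x: "poly ?S x \<noteq> 0" for x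
  proof (cases "\<epsilon> \<ge> 1")
    case True
    then have "(1 - \<epsilon>) * height x \<le> 0" using height_nonneg[of x] by (simp add: mult_le_0_iff)
    then show ?thesis using lrad_nonneg[of "poly ?S x"] by linarith
  next
    case False
    obtain a b where ab: "b > 0" "coprime a b" "x = of_int a / of_int b"
      "height x = ln (real_of_int (max \<bar>a\<bar> b))" using height_lowest_terms[of x] .
    have S: "poly ?S x = of_int (a * (a - b)) / of_int (b * b)"
      using ab(1) by (simp add: ab(3) field_simps)
    have nz: "a \<noteq> 0" "b - a \<noteq> 0" "- b \<noteq> 0" using x ab(1) unfolding S by auto
    have cop: "coprime a (b - a)" using ab(2) by (metis coprime_iff_gcd_eq_1 gcd.commute gcd_diff1)
    have "prime_factors (a * (b - a) * (- b)) \<subseteq> supp (poly ?S x)"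
    proof
      fix p assume "p \<in> prime_factors (a * (b - a) * (- b))"
      then have "prime p" "p dvd a * (b - a) * (- b)" by blast+
      then have p: "prime p" "p dvd a \<or> p dvd b - a \<or> p dvd b" by (simp_all add: prime_dvd_mult_iff)
      have "\<not> loc_unit p (poly ?S x)"
      proof
        assume "loc_unit p (poly ?S x)"
        then obtain u v where u: "\<not> p dvd u" "\<not> p dvd v" "poly ?S x = of_int u / of_int v"
          using loc_unit_iff[OF p(1)] by blast
        have "v \<noteq> 0" using u by auto
        then have "(of_int (a * (a - b) * v) :: rat) = of_int (u * (b * b))"
          using u(3) ab(1) unfolding S by (simp add: field_simps)
        then have e: "a * (a - b) * v = u * (b * b)" by (simp only: of_int_eq_iff)
        \<comment> \<open>If x (x - 1) is a unit, \<open>p\<close> divides a (a - b) exactly when it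
          divides b; so dividing one of a, b - a, b it divides both a and b, contrary to
          coprimality.\<close>
        have "p dvd b \<longleftrightarrow> p dvd a \<or> p dvd a - b"
          using arg_cong[OF e, of "\<lambda>t. p dvd t"] u(1,2) p(1) by (simp add: prime_dvd_mult_iff)
        moreover have "p dvd b - a \<longleftrightarrow> p dvd a - b" by (metis dvd_minus_iff minus_diff_eq)
        moreover have "p dvd b \<Longrightarrow> p dvd a - b \<Longrightarrow> p dvd a" by (metis diff_add_cancel dvd_add)
        ultimately have "p dvd a" "p dvd b" using p(2) by blast+
        then show False using ab(2) p(1) by (meson coprime_common_divisor not_prime_unit)
      qed
      then show "p \<in> supp (poly ?S x)" using p(1) by (simp add: supp_def)
    qed
    then have "(\<Sum>p\<in>prime_factors (a * (b - a) * (- b)). ln (real_of_int p)) \<le> lrad (poly ?S x)"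
      unfolding lrad_def using finite_supp[OF x] by (intro sum_mono2) (auto simp: supp_def ln_prime_nonneg)
    then have "(1 + \<epsilon>) * (\<Sum>p\<in>prime_factors (a * (b - a) * (- b)). ln (real_of_int p)) \<le> (1 + \<epsilon>) * lrad (poly ?S x)"
      using \<epsilon> by (intro mult_left_mono) auto
    moreover have "height x \<le> ln (max \<bar>real_of_int a\<bar> (max \<bar>real_of_int (b - a)\<bar> \<bar>real_of_int (- b)\<bar>))"
      unfolding ab(4) using ab(1) by (intro ln_mono) auto
    ultimately have "height x \<le> (1 + \<epsilon>) * lrad (poly ?S x) + C"
      using C[OF nz _ cop] by linarith
    \<comment> \<open>The loss moves from the radical to the height because (1 - \<epsilon>) (1 +
      \<epsilon>) \<le> 1.\<close>
    then have "(1 - \<epsilon>) * height x \<le> (1 - \<epsilon>) * ((1 + \<epsilon>) * lrad (poly ?S x) + C)"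
      using False by (intro mult_left_mono) auto
    also have "\<dots> = lrad (poly ?S x) - \<epsilon>\<^sup>2 * lrad (poly ?S x) + (1 - \<epsilon>) * C"
      by (simp add: algebra_simps power2_eq_square)
    also have "\<dots> \<le> lrad (poly ?S x) + \<bar>C\<bar>"
    proof -
      have "(1 - \<epsilon>) * C \<le> (1 - \<epsilon>) * \<bar>C\<bar>" using False by (intro mult_left_mono) auto
      also have "\<dots> \<le> 1 * \<bar>C\<bar>" using \<epsilon> by (intro mult_right_mono) auto
      finally have "(1 - \<epsilon>) * C \<le> \<bar>C\<bar>" by simp
      moreover have "0 \<le> \<epsilon>\<^sup>2 * lrad (poly ?S x)" using lrad_nonneg by simp
      ultimately show ?thesis by linarith
    qed
    finally show ?thesis .
  qed
  then show "\<exists>C. \<forall>x. poly ?S x \<noteq> 0 \<longrightarrow> (real (degree ?S) - 1 - \<epsilon>) * height x \<le> lrad (poly ?S x) + C"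
    by (intro exI[of _ "\<bar>C\<bar>"]) simp
qed

section \<open>Belyi maps\<close>

text \<open>A pullback of degree one, where the degree condition becomes equality of degrees.
  Divisibility in place of equality absorbs constant factors.\<close>

lemma vojta_affine:
  assumes "vojta S" "degree S > 0" "\<alpha> \<noteq> 0" "pcompose S [:\<beta>, \<alpha>:] dvd S'" "degree S' = degree S"
  shows "vojta S'"
proof (rule vojta_pullback)
  show "pcompose S [:\<beta>, \<alpha>:] dvd S' ^ 1" using assms(4) by simp
qed (use assms in auto)

lemma dvd_of_poly_eq:
  fixes F G :: "rat poly"
  assumes "\<And>x. poly G x = poly F x * poly H x"
  shows "F dvd G"
proof -
  have "G = F * H" using assms by (intro iffD1[OF poly_eq_poly_eq_iff]) auto
  then show ?thesis by simp
qed

lemma double_root: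
  fixes q :: "rat poly"
  assumes "poly q l = 0" "poly (pderiv q) l = 0"
  shows "[:- l, 1:]\<^sup>2 dvd q"
proof -
  obtain r where r: "q = [:- l, 1:] * r" using assms(1) by (auto simp: poly_eq_0_iff_dvd)
  have "poly (pderiv q) l = poly r l" unfolding r pderiv_mult by (simp add: pderiv_pCons)
  then have "poly r l = 0" using assms(2) by simp
  then obtain t where "r = [:- l, 1:] * t" by (auto simp: poly_eq_0_iff_dvd)
  then have "q = [:- l, 1:]\<^sup>2 * t" using r by (simp only: power2_eq_square mult.assoc)
  then show ?thesis by (rule dvdI)
qed

text \<open>Belyi's map \<open>c x\<^sup>m (x - 1)\<^sup>n\<close> with \<open>l = m / (m + n)\<close>: its only critical point besides
  0 and 1 is \<open>l\<close>, where \<open>c\<close> makes its value 1.\<close>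

lemma vojta_zero_one_between:
  assumes abc: "uniform_abc_conjecture" and l: "0 < l" "l < 1"
  shows "vojta ([:0, 1:] * [:-1, 1:] * [:- l, 1:])"
proof -
  obtain a b where ab: "b > 0" "coprime a b" "l = of_int a / of_int b" using rat_lowest_terms by blast
  have a: "0 < a" "a < b" using l ab by (auto simp: zero_less_divide_iff)
  define m where "m = nat a"
  define n where "n = nat (b - a)"
  have mn: "m > 0" "n > 0" "of_nat m = (of_int a :: rat)" "of_nat n = (of_int (b - a) :: rat)"
    using a by (auto simp: m_def n_def)
  let ?X = "[:0, 1:] :: rat poly" and ?Y = "[:-1, 1:] :: rat poly" and ?L = "[:- l, 1:] :: rat poly"
  define c where "c = 1 / (l ^ m * (l - 1) ^ n)"
  define \<beta> where "\<beta> = smult c (?X ^ m * ?Y ^ n)"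
  have c: "c \<noteq> 0" "c * (l ^ m * (l - 1) ^ n) = 1" using l by (auto simp: c_def)
  have deg: "degree \<beta> = m + n"
    unfolding \<beta>_def using c(1) by (simp add: degree_mult_eq degree_power_eq)
  have "poly (\<beta> - 1) l = 0" using c(2) by (simp add: \<beta>_def)
  moreover have "poly (pderiv (\<beta> - 1)) l = 0"
  proof -
    obtain m' n' where mn': "m = Suc m'" "n = Suc n'" using mn(1,2) by (metis gr0_implies_Suc)
    have dX: "pderiv (?X ^ Suc m') = smult (of_nat (Suc m')) (?X ^ m')"
      by (subst pderiv_power_Suc) (simp add: pderiv_pCons)
    have dY: "pderiv (?Y ^ Suc n') = smult (of_nat (Suc n')) (?Y ^ n')"
      by (subst pderiv_power_Suc) (simp add: pderiv_pCons)
    have "poly (pderiv (\<beta> - 1)) l = c * (l ^ m' * (l - 1) ^ n' * (of_nat m * (l - 1) + of_nat n * l))"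
      unfolding \<beta>_def mn' pderiv_diff pderiv_smult pderiv_mult dX dY by (simp add: algebra_simps)
    also have "of_nat m * (l - 1) + of_nat n * l = l * (of_nat m + of_nat n) - of_nat m"
      by (simp add: algebra_simps)
    also have "\<dots> = 0" using mn(3,4) ab by simp
    finally show ?thesis by simp
  qed
  ultimately obtain T where T: "\<beta> - 1 = ?L\<^sup>2 * T" using double_root by blast
  have "degree (\<beta> - 1) = m + n"
    using degree_add_eq_left[of "- 1" \<beta>] deg mn by simp
  moreover from this have "T \<noteq> 0" using T mn by auto
  ultimately have dT: "degree T + 2 = m + n"
    unfolding T by (simp add: degree_mult_eq degree_power_eq)
  let ?S = "?X * ?Y * ?L * T"
  have "vojta ?S"
  proof (rule vojta_pullback[OF vojta_zero_one[OF abc], of \<beta>])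
    have "pcompose (?X * ?Y) \<beta> = \<beta> * (\<beta> - 1)"
      by (intro iffD1[OF poly_eq_poly_eq_iff]) (auto simp: poly_pcompose)
    also have "\<dots> = smult c (?X ^ m * ?Y ^ n * (?L\<^sup>2 * T))" unfolding T by (simp add: \<beta>_def)
    finally have e: "pcompose (?X * ?Y) \<beta> = smult c (?X ^ m * ?Y ^ n * (?L\<^sup>2 * T))" .
    have "?X dvd ?S" "?Y dvd ?S" "?L dvd ?S" "?L * T dvd ?S"
      by (intro dvd_mult2 dvd_refl, metis dvd_mult2 dvd_triv_right, metis dvd_mult2 dvd_triv_right,
          metis dvd_triv_right mult.assoc)
    \<comment> \<open>One copy of \<open>?S\<close> is spent per multiplicity: \<open>m\<close> at
      0, \<open>n\<close> at 1 and two at \<open>l\<close>, one of which also covers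
      \<open>T\<close>.\<close>
    then have "?X ^ m * ?Y ^ n * (?L * (?L * T)) dvd ?S ^ m * ?S ^ n * (?S * ?S)"
      by (metis dvd_power_same mult_dvd_mono)
    then have "?X ^ m * ?Y ^ n * (?L\<^sup>2 * T) dvd ?S ^ (m + n + 2)"
      by (simp only: power_add power2_eq_square mult.assoc)
    then show "pcompose (?X * ?Y) \<beta> dvd ?S ^ (m + n + 2)"
      unfolding e using c(1) by (rule smult_dvd)
    \<comment> \<open>Three linear factors and \<open>degree T = m + n - 2\<close> give m + n + 1,
      the Riemann-Hurwitz value for a map of degree m + n and two points.\<close>
    have "degree ?S = degree (?X * ?Y * ?L) + degree T"
      by (rule degree_mult_eq) (use \<open>T \<noteq> 0\<close> in auto)
    then have "degree ?S = 3 + degree T" by simp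
    moreover have "degree (?X * ?Y) = 2" by (simp add: degree_mult_eq)
    ultimately show "degree ?S = degree \<beta> * (degree (?X * ?Y) - 1) + 1"
      unfolding deg using dT by simp
  qed (use deg mn in \<open>auto simp: degree_mult_eq\<close>)
  then show ?thesis by (rule vojta_factor) (use \<open>T \<noteq> 0\<close> in auto)
qed

text \<open>An affine map carries the outer two points to 0 and 1. Sorting puts the image of the
  third strictly between them, where Belyi's map has positive exponents.\<close>

lemma vojta_three_points:
  assumes abc: "uniform_abc_conjecture" and "r \<noteq> s" "s \<noteq> u" "r \<noteq> u"
  shows "vojta ([:- r, 1:] * [:- s, 1:] * [:- u, 1:])"
proof -
  have sorted: "vojta ([:- r, 1:] * [:- s, 1:] * [:- u, 1:])" if "r < s" "s < u" for r s u
  proof -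
    define l where "l = (s - r) / (u - r)"
    have l: "0 < l" "l < 1" using that by (auto simp: l_def field_simps)
    have d: "u - r \<noteq> 0" using that by auto
    show ?thesis
    proof (rule vojta_affine[OF vojta_zero_one_between[OF abc l], of "1 / (u - r)" "- r / (u - r)"])
      show "pcompose ([:0, 1:] * [:-1, 1:] * [:- l, 1:]) [:- r / (u - r), 1 / (u - r):]
          dvd [:- r, 1:] * [:- s, 1:] * [:- u, 1:]"
      proof (rule dvd_of_poly_eq[where H = "[:(u - r) ^ 3:]"])
        fix x
        define v where "v = (x - r) / (u - r)"
        have v: "poly [:- r / (u - r), 1 / (u - r):] x = v"
          by (simp add: v_def diff_divide_distrib)
        have vl: "v * (u - r) = x - r" "l * (u - r) = s - r" using d by (simp_all add: v_def l_def)
        have "x - r = v * (u - r)" "x - s = (v - l) * (u - r)" "x - u = (v - 1) * (u - r)"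
          using vl by (simp_all add: left_diff_distrib)
        then have "(x - r) * (x - s) * (x - u) = v * (v - 1) * (v - l) * (u - r) ^ 3"
          by (simp add: power3_eq_cube)
        then show "poly ([:- r, 1:] * [:- s, 1:] * [:- u, 1:]) x
            = poly (pcompose ([:0, 1:] * [:-1, 1:] * [:- l, 1:]) [:- r / (u - r), 1 / (u - r):]) x
              * poly [:(u - r) ^ 3:] x"
          unfolding poly_pcompose v poly_mult by simp
      qed
    qed (use d in \<open>auto simp: degree_mult_eq\<close>)
  qed
  consider "r < s \<and> s < u" | "r < u \<and> u < s" | "s < r \<and> r < u" | "s < u \<and> u < r" | "u < r \<and> r < s" | "u < s \<and> s < r"
    using assms(2-4) by linarith
  then show ?thesis
    by cases (use sorted[of r s u] sorted[of r u s] sorted[of s r u] sorted[of s u r] sorted[of u r s]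
      sorted[of u s r] in \<open>simp_all only: mult_ac\<close>)
qed

lemma vojta_two_points:
  assumes abc: "uniform_abc_conjecture" and "s \<noteq> 0"
  shows "vojta ([:0, 1:] * [:- s, 1:])"
proof (rule vojta_affine[OF vojta_zero_one[OF abc], of "1 / s" 0])
  show "pcompose ([:0, 1:] * [:-1, 1:]) [:0, 1 / s:] dvd [:0, 1:] * [:- s, 1:]"
    using assms(2)
    by (intro dvd_of_poly_eq[where H = "[:s\<^sup>2:]"]) (simp add: poly_pcompose field_simps power2_eq_square)
qed (use assms(2) in \<open>auto simp: degree_mult_eq\<close>)

text \<open>The map x^3 + p x has the value - q at every root, but its critical values are the two
  square roots of - 4 p^3 / 27. Squaring the map merges them into a rational number at the price of
  the new critical value 0. If p or q vanishes, the three values 0, q^2, - 4 p^3 / 27 are no longer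
  distinct, and a power map serves instead.\<close>

lemma vojta_depressed_cubic:
  fixes p q :: rat
  assumes abc: "uniform_abc_conjecture" and disc: "4 * p ^ 3 + 27 * q\<^sup>2 \<noteq> 0"
  shows "vojta [:q, p, 0, 1:]"
proof -
  let ?X = "[:0, 1:] :: rat poly"
  consider "p = 0" | "q = 0" "p \<noteq> 0" | "p \<noteq> 0" "q \<noteq> 0" by blast
  then show ?thesis
  proof cases
    \<comment> \<open>The only finite critical value of x^3 is 0. Over 0 and - q lie 0 and the three
      roots, 4 = 3 (2 - 1) + 1 points; the factor \<open>?X\<close> is discarded afterwards.\<close>
    case 1
    then have q: "- q \<noteq> 0" using disc by auto
    have "vojta ([:q, p, 0, 1:] * ?X)"
    proof (rule vojta_pullback[OF vojta_two_points[OF abc q], of "monom 1 3"])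
      show "pcompose (?X * [:- (- q), 1:]) (monom 1 3) dvd ([:q, p, 0, 1:] * ?X) ^ 3"
        using 1 by (intro dvd_of_poly_eq[where H = "[:q, p, 0, 1:]\<^sup>2"])
          (simp add: poly_pcompose poly_monom algebra_simps power2_eq_square power3_eq_cube)
    qed (auto simp: degree_mult_eq degree_monom_eq)
    then show ?thesis by (rule vojta_factor) auto
  next
    \<comment> \<open>Here x (x^2 + p) is already the full preimage of 0 and - p under
      squaring.\<close>
    case 2
    then have p: "- p \<noteq> 0" by auto
    show ?thesis
    proof (rule vojta_pullback[OF vojta_two_points[OF abc p], of "monom 1 2"])
      show "pcompose (?X * [:- (- p), 1:]) (monom 1 2) dvd [:q, p, 0, 1:] ^ 2"
        using 2 by (intro dvd_of_poly_eq[where H = "[:p, 0, 1:]"])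
          (simp add: poly_pcompose poly_monom algebra_simps power2_eq_square)
    qed (auto simp: degree_mult_eq degree_monom_eq)
  next
    case 3
    \<comment> \<open>The map \<open>(x\<^sup>3 + p x)\<^sup>2\<close> has the critical values 0 and \<open>- 4 p\<^sup>3 / 27\<close>, and takes the
      value \<open>q\<^sup>2\<close> at the roots of the cubic.\<close>
    define A where "A = q\<^sup>2"
    define B where "B = - 4 * p ^ 3 / 27"
    \<comment> \<open>These factor the three fibres of \<open>\<psi>\<close>: \<open>k\<close> gives
      the fibre over 0, \<open>f * f'\<close> that over \<open>A\<close>, and \<open>g * h\<close>
      that over \<open>B\<close>, where \<open>g\<close> is the derivative of \<open>k\<close> and
      so carries the double points.\<close>
    define f f' g h k where "f = [:q, p, 0, 1:]" and "f' = [:- q, p, 0, 1:]"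
      and "g = [:p, 0, 3:]" and "h = [:4 * p, 0, 3:]"
      and "k = [:0, p, 0, 1:]"
    define \<psi> where "\<psi> = k\<^sup>2"
    \<comment> \<open>\<open>A \<noteq> B\<close> is precisely the discriminant hypothesis.\<close>
    have AB: "0 \<noteq> A" "A \<noteq> B" "0 \<noteq> B" using 3 disc by (auto simp: A_def B_def)
    have nz: "f \<noteq> 0" "f' \<noteq> 0" "g \<noteq> 0" "h \<noteq> 0" "k \<noteq> 0"
      by (auto simp: f_def f'_def g_def h_def k_def)
    let ?R = "f' * k * g * h"
    have "vojta (f * ?R)"
    proof (rule vojta_pullback[OF vojta_three_points[OF abc AB], of \<psi>])
      show "pcompose ([:- 0, 1:] * [:- A, 1:] * [:- B, 1:]) \<psi> dvd (f * ?R) ^ 2"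
      proof (rule dvd_of_poly_eq[where H = "[:27:] * h * f * f'"])
        fix x
        have 1: "poly \<psi> x - A = poly f x * poly f' x"
          by (simp add: \<psi>_def k_def A_def f_def f'_def algebra_simps power2_eq_square)
        have 2: "27 * (poly \<psi> x - B) = (poly g x)\<^sup>2 * poly h x"
          by (simp add: \<psi>_def k_def B_def g_def h_def algebra_simps power2_eq_square power3_eq_cube)
        have 3: "poly \<psi> x = (poly k x)\<^sup>2" by (simp add: \<psi>_def)
        have "poly ((f * ?R) ^ 2) x = (poly k x)\<^sup>2 * (poly f x * poly f' x)
            * ((poly g x)\<^sup>2 * poly h x) * (poly h x * poly f x * poly f' x)"
          by (simp add: power2_eq_square mult_ac)
        also have "\<dots> = poly \<psi> x * (poly \<psi> x - A) * (poly \<psi> x - B) * (27 * poly h x * poly f x * poly f' x)"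
          unfolding 1[symmetric] 2[symmetric] 3[symmetric] by simp
        also have "\<dots> = poly (pcompose ([:- 0, 1:] * [:- A, 1:] * [:- B, 1:]) \<psi>) x * poly ([:27:] * h * f * f') x"
          unfolding poly_pcompose poly_mult by (simp add: mult_ac)
        finally show "poly ((f * ?R) ^ 2) x = \<dots>" .
      qed
      have "degree \<psi> = 6" unfolding \<psi>_def k_def by (simp add: degree_power_eq)
      \<comment> \<open>3 + 3 + 3 + 2 + 2 = 6 (3 - 1) + 1, so the degree condition of the pullback
        is met.\<close>
      moreover have "degree (f * ?R) = 13"
        using nz by (simp add: degree_mult_eq) (simp add: f_def f'_def g_def h_def k_def)
      moreover have "degree ([:- 0, 1:] * [:- A, 1:] * [:- B, 1:]) = 3" by (simp add: degree_mult_eq)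
      ultimately show "degree (f * ?R) = degree \<psi> * (degree ([:- 0, 1:] * [:- A, 1:] * [:- B, 1:]) - 1) + 1"
        "0 < degree \<psi>" "0 < degree ([:- 0, 1:] * [:- A, 1:] * [:- B, 1:])" by simp_all
    qed
    then have "vojta f" by (rule vojta_factor) (use nz in \<open>auto simp: f_def\<close>)
    then show ?thesis by (simp add: f_def)
  qed
qed

section \<open>Elliptic curves\<close>

text \<open>The classical 4 x^3 + b2 x^2 + 2 b4 x + b6, whose roots are the x-coordinates of the
  points of order two.\<close>

definition two_division_poly :: "int_weierstrass \<Rightarrow> rat poly" where
  "two_division_poly E = [:of_int ((a3 E)\<^sup>2 + 4 * a6 E), of_int (2 * (2 * a4 E + a1 E * a3 E)),
     of_int ((a1 E)\<^sup>2 + 4 * a2 E), 4:]"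

lemma degree_two_division_poly: "degree (two_division_poly E) = 3"
  by (simp add: two_division_poly_def)

lemma poly_two_division_poly:
  assumes "on_curve E x y"
  shows "poly (two_division_poly E) x = (2 * y + of_int (a1 E) * x + of_int (a3 E))\<^sup>2"
proof -
  have "(2 * y + of_int (a1 E) * x + of_int (a3 E))\<^sup>2
      = 4 * (y\<^sup>2 + of_int (a1 E) * x * y + of_int (a3 E) * y) + (of_int (a1 E) * x + of_int (a3 E))\<^sup>2"
    by (simp add: power2_eq_square algebra_simps)
  also have "\<dots> = poly (two_division_poly E) x"
    unfolding assms[unfolded on_curve_def]
    by (simp add: two_division_poly_def power2_eq_square power3_eq_cube algebra_simps)
  finally show ?thesis by simp
qed

text \<open>The shift by b2 / 12 removes the quadratic term. After b8 is eliminated through 4 b8 =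
  b2 b6 - b4^2, the Weierstrass discriminant is -16 times the quantity that has to be nonzero for
  the depressed cubic.\<close>

lemma vojta_two_division_poly:
  assumes abc: "uniform_abc_conjecture" and E: "elliptic_curve E"
  shows "vojta (two_division_poly E)"
proof -
  define b2 b4 b6 b8 where "b2 = (a1 E)\<^sup>2 + 4 * a2 E" and "b4 = 2 * a4 E + a1 E * a3 E"
    and "b6 = (a3 E)\<^sup>2 + 4 * a6 E"
    and "b8 = (a1 E)\<^sup>2 * a6 E + 4 * a2 E * a6 E - a1 E * a3 E * a4 E + a2 E * (a3 E)\<^sup>2 - (a4 E)\<^sup>2"
  define u v w where "u = (of_int b2 :: rat)" and "v = (of_int b4 :: rat)" and "w = (of_int b6 :: rat)"
  have F: "two_division_poly E = [:w, 2 * v, u, 4:]"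
    by (simp add: two_division_poly_def u_def v_def w_def b2_def b4_def b6_def)
  have "4 * b8 = b2 * b6 - b4\<^sup>2"
    by (simp add: b2_def b4_def b6_def b8_def power2_eq_square algebra_simps)
  then have "(of_int (4 * b8) :: rat) = of_int (b2 * b6 - b4\<^sup>2)" by (simp only:)
  then have b8: "(of_int b8 :: rat) = (u * w - v\<^sup>2) / 4" by (simp add: u_def v_def w_def)
  define p q where "p = v / 2 - u\<^sup>2 / 48" and "q = w / 4 - u * v / 24 + u ^ 3 / 864"
  have "(of_int (weierstrass_disc E) :: rat)
      = - u\<^sup>2 * of_int b8 - 8 * v ^ 3 - 27 * w\<^sup>2 + 9 * u * v * w"
    unfolding weierstrass_disc_def Let_def b2_def[symmetric] b4_def[symmetric] b6_def[symmetric]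
      b8_def[symmetric] by (simp add: u_def v_def w_def)
  also have "\<dots> = - 16 * (4 * p ^ 3 + 27 * q\<^sup>2)"
    unfolding b8 p_def q_def by (simp add: power2_eq_square power3_eq_cube field_simps)
  finally have "4 * p ^ 3 + 27 * q\<^sup>2 \<noteq> 0" using E by (auto simp: elliptic_curve_def)
  then have "vojta [:q, p, 0, 1:]" by (rule vojta_depressed_cubic[OF abc])
  then show ?thesis
  proof (rule vojta_affine[of _ 1 "u / 12"])
    show "pcompose [:q, p, 0, 1:] [:u / 12, 1:] dvd two_division_poly E"
      unfolding F
      by (rule dvd_of_poly_eq[where H = "[:4:]"])
        (simp add: poly_pcompose p_def q_def power2_eq_square power3_eq_cube field_simps)
  qed (simp_all add: degree_two_division_poly)
qed

text \<open>On the curve the value is w^2 / d^6 with an integer w. Its primes divide d, which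
  accounts for the radical, or w; and log \<bar>w\<bar> is at most half the logarithm of a cubic
  form in a and d^2, up to a constant. Being a square is what turns 3 into 3/2.\<close>

lemma lrad_two_division_poly_le:
  obtains C where "\<And>P. P \<in> rational_points E - {Infinity} \<Longrightarrow>
      poly (two_division_poly E) (of_int (point_a P) / of_int (point_d P) ^ 2) \<noteq> 0 \<Longrightarrow>
      lrad (poly (two_division_poly E) (of_int (point_a P) / of_int (point_d P) ^ 2))
        \<le> ln (real_of_int (rad (point_d P)))
          + 3 / 2 * height (of_int (point_a P) / of_int (point_d P) ^ 2) + C"
proof -
  define F where "F = two_division_poly E"
  obtain k C where kC: "k > 0" "C > 0" "\<forall>a b. b > 0 \<longrightarrow> (\<exists>N. of_int N = of_int k * of_int b ^ 3 * poly F (of_int a / of_int b)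
           \<and> \<bar>real_of_int N\<bar> \<le> C * real_of_int (max \<bar>a\<bar> b) ^ 3)"
    using homogenization[of F 3] degree_two_division_poly[of E] by (auto simp: F_def)
  have "lrad (poly F (of_int (point_a P) / of_int (point_d P) ^ 2))
        \<le> ln (real_of_int (rad (point_d P)))
          + 3 / 2 * height (of_int (point_a P) / of_int (point_d P) ^ 2) + ln C / 2"
    if P: "P \<in> rational_points E - {Infinity}"
      and nz: "poly F (of_int (point_a P) / of_int (point_d P) ^ 2) \<noteq> 0" for P
  proof -
    define a d where "a = point_a P" and "d = point_d P"
    obtain b where "point_repr P a b d" using point_repr_iff[OF P] unfolding a_def d_def by blast
    then have r: "d \<ge> 1" "gcd d (a * b) = 1" "P = Affine (of_int a / of_int d ^ 2) (of_int b / of_int d ^ 3)"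
      by (auto simp: point_repr_def)
    define x y :: rat where "x = of_int a / of_int d ^ 2" and "y = of_int b / of_int d ^ 3"
    have on: "on_curve E x y" using P r(3) by (auto simp: rational_points_def x_def y_def)
    \<comment> \<open>The numerator of 2 y + a1 x + a3 over d^3. Common factors with d do no harm,
      since only an upper bound for the set of primes is wanted.\<close>
    define w where "w = 2 * b + a1 E * a * d + a3 E * d ^ 3"
    have "2 * y + of_int (a1 E) * x + of_int (a3 E) = of_int w / of_int (d ^ 3)"
      using r(1) by (simp add: x_def y_def w_def field_simps power2_eq_square power3_eq_cube)
    then have "poly F x = (of_int w / of_int (d ^ 3))\<^sup>2"
      using poly_two_division_poly[OF on] by (simp add: F_def)
    then have Fx: "poly F x = of_int (w\<^sup>2) / of_int ((d ^ 3)\<^sup>2)" by (simp add: power_divide)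
    have w0: "w \<noteq> 0" using nz Fx by (auto simp: x_def a_def d_def)
    have "coprime a (d\<^sup>2)" using r(2) by (simp add: coprime_iff_gcd_eq_1[symmetric] coprime_commute)
    then have h: "height x = ln (real_of_int (max \<bar>a\<bar> (d\<^sup>2)))"
      using height_eq[of "d\<^sup>2" a] r(1) by (simp add: x_def)
    have "supp (poly F x) \<subseteq> prime_factors (w\<^sup>2 * (d ^ 3)\<^sup>2)"
      using w0 r(1) by (intro supp_subset_prime_factors[OF Fx]) auto
    also have "\<dots> \<subseteq> prime_factors d \<union> prime_factors w"
      using w0 r(1) by (auto simp: prime_factors_dvd prime_dvd_mult_iff dest: prime_dvd_power)
    finally have "lrad (poly F x)
        \<le> (\<Sum>p\<in>prime_factors d. ln (of_int p)) + (\<Sum>p\<in>prime_factors w. ln (of_int p))"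
      by (rule lrad_le) auto
    also have "(\<Sum>p\<in>prime_factors w. ln (real_of_int p)) \<le> ln \<bar>real_of_int w\<bar>"
      by (rule sum_ln_prime_factors_le[OF w0])
    also have "ln \<bar>real_of_int w\<bar> \<le> 3 / 2 * height x + ln C / 2"
    proof -
      have "d\<^sup>2 > 0" using r(1) by simp
      then have H: "real_of_int (max \<bar>a\<bar> (d\<^sup>2)) > 0" by linarith
      from \<open>d\<^sup>2 > 0\<close> obtain N where N: "of_int N = of_int k * of_int (d\<^sup>2) ^ 3 * poly F (of_int a / of_int (d\<^sup>2))"
        "\<bar>real_of_int N\<bar> \<le> C * real_of_int (max \<bar>a\<bar> (d\<^sup>2)) ^ 3" using kC(3) by blast
      have "of_int a / of_int (d\<^sup>2) = x" by (simp add: x_def)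
      then have "(of_int N :: rat) = of_int (k * w\<^sup>2)"
        using N(1) r(1) unfolding Fx[symmetric] by (simp add: Fx field_simps flip: power_mult)
      then have "N = k * w\<^sup>2" by (simp only: of_int_eq_iff)
      then have "w\<^sup>2 \<le> \<bar>N\<bar>" using kC(1) mult_right_mono[of 1 k "w\<^sup>2"] by (simp add: abs_mult)
      then have "real_of_int w ^ 2 \<le> \<bar>real_of_int N\<bar>" by (metis of_int_abs of_int_le_iff of_int_power)
      then have "\<bar>real_of_int w\<bar> ^ 2 \<le> C * real_of_int (max \<bar>a\<bar> (d\<^sup>2)) ^ 3" using N(2) by simp
      then have "ln (\<bar>real_of_int w\<bar> ^ 2) \<le> ln (C * real_of_int (max \<bar>a\<bar> (d\<^sup>2)) ^ 3)"
        using w0 by (intro ln_mono) auto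
      also have "\<dots> = ln C + 3 * height x"
        using kC(2) H unfolding h by (simp add: ln_mult ln_realpow)
      also have "ln (\<bar>real_of_int w\<bar> ^ 2) = 2 * ln \<bar>real_of_int w\<bar>"
        using w0 by (subst ln_realpow) auto
      finally show ?thesis by linarith
    qed
    finally show ?thesis by (simp add: ln_rad x_def a_def d_def)
  qed
  then show ?thesis using that unfolding F_def by blast
qed

theorem theorem1p3:
  fixes E :: int_weierstrass
  assumes "uniform_abc_conjecture"
    and "elliptic_curve E"
  shows "\<forall>\<epsilon>::real. \<epsilon> > 0 \<longrightarrow> (\<exists>c::real. \<forall>P \<in> rational_points E - {Infinity}.
           max (1 / 2 * ln \<bar>real_of_int (point_a P)\<bar>) (ln \<bar>real_of_int (point_d P)\<bar>)
             \<le> (1 + \<epsilon>) * ln (real_of_int (rad (point_d P))) + c)"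
proof (intro allI impI)
  fix \<epsilon> :: real assume \<epsilon>: "\<epsilon> > 0"
  define F where "F = two_division_poly E"
  have F0: "F \<noteq> 0" using degree_two_division_poly[of E] by (auto simp: F_def)
  \<comment> \<open>Chosen so that dividing by 1/2 - \<delta> amounts to multiplying by 2 (1 +
    \<epsilon>); the factor 2 is used up by the target, which involves only half the height.\<close>
  define \<delta> where "\<delta> = \<epsilon> / (2 * (1 + \<epsilon>))"
  have \<delta>: "\<delta> > 0" "1 / 2 - \<delta> = 1 / (2 * (1 + \<epsilon>))" using \<epsilon> by (auto simp: \<delta>_def field_simps)
  obtain C where C: "\<And>x. poly F x \<noteq> 0 \<Longrightarrow> (2 - \<delta>) * height x \<le> lrad (poly F x) + C"
    using vojtaE[OF vojta_two_division_poly[OF assms] \<delta>(1)] by (auto simp: F_def degree_two_division_poly)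
  obtain D where D: "\<And>P. P \<in> rational_points E - {Infinity} \<Longrightarrow>
      poly F (of_int (point_a P) / of_int (point_d P) ^ 2) \<noteq> 0 \<Longrightarrow>
      lrad (poly F (of_int (point_a P) / of_int (point_d P) ^ 2))
        \<le> ln (real_of_int (rad (point_d P)))
          + 3 / 2 * height (of_int (point_a P) / of_int (point_d P) ^ 2) + D"
    using lrad_two_division_poly_le[of E] unfolding F_def by blast
  \<comment> \<open>This takes care of the points of order two, whose x-coordinates are the finitely
    many rational roots of \<open>F\<close> that the inequality leaves out.\<close>
  define M where "M = (\<Sum>x | poly F x = 0. height x)"
  have M: "0 \<le> M" unfolding M_def by (intro sum_nonneg) (auto simp: height_nonneg)
  have "max (1 / 2 * ln \<bar>real_of_int (point_a P)\<bar>) (ln \<bar>real_of_int (point_d P)\<bar>)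
             \<le> (1 + \<epsilon>) * ln (real_of_int (rad (point_d P))) + ((1 + \<epsilon>) * \<bar>C + D\<bar> + M)"
    if P: "P \<in> rational_points E - {Infinity}" for P
  proof -
    define a d where "a = point_a P" and "d = point_d P"
    define x :: rat where "x = of_int a / of_int d ^ 2"
    obtain b where "point_repr P a b d" using point_repr_iff[OF P] unfolding a_def d_def by blast
    then have r: "d \<ge> 1" "gcd d (a * b) = 1" by (auto simp: point_repr_def)
    have "coprime a (d\<^sup>2)" using r(2) by (simp add: coprime_iff_gcd_eq_1[symmetric] coprime_commute)
    then have h: "height x = ln (real_of_int (max \<bar>a\<bar> (d\<^sup>2)))"
      using height_eq[of "d\<^sup>2" a] r(1) by (simp add: x_def)
    have "ln \<bar>real_of_int a\<bar> \<le> height x"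
    \<comment> \<open>For \<open>a = 0\<close> the logarithm is 0 in HOL and the bound becomes
      nonnegativity of the height.\<close>
    proof (cases "a = 0")
      case True
      then show ?thesis using height_nonneg by simp
    next
      case False
      then show ?thesis unfolding h by (intro ln_mono) auto
    qed
    moreover have "2 * ln \<bar>real_of_int d\<bar> \<le> height x"
    proof -
      have "ln (real_of_int (d\<^sup>2)) \<le> height x" unfolding h using r(1) by (intro ln_mono) auto
      then show ?thesis using r(1) by (simp add: ln_realpow)
    qed
    ultimately have le: "max (1 / 2 * ln \<bar>real_of_int a\<bar>) (ln \<bar>real_of_int d\<bar>) \<le> height x / 2" by simp
    have rd: "ln (real_of_int (rad d)) \<ge> 0"
      unfolding ln_rad by (intro sum_nonneg ln_prime_nonneg) auto
    have "height x / 2 \<le> (1 + \<epsilon>) * ln (real_of_int (rad d)) + ((1 + \<epsilon>) * \<bar>C + D\<bar> + M)"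
    proof (cases "poly F x = 0")
      case True
      have "height x \<le> M"
        unfolding M_def using True poly_roots_finite[OF F0] by (intro member_le_sum) (auto simp: height_nonneg)
      moreover have "0 \<le> (1 + \<epsilon>) * ln (real_of_int (rad d))" "0 \<le> (1 + \<epsilon>) * \<bar>C + D\<bar>"
        using \<epsilon> rd by simp_all
      ultimately show ?thesis using height_nonneg[of x] by linarith
    next
      case False
      have "(2 - \<delta>) * height x \<le> ln (real_of_int (rad d)) + 3 / 2 * height x + D + C"
        using C[OF False] D[OF P] False unfolding x_def a_def d_def by fastforce
      \<comment> \<open>The surplus 1/2 is the coefficient 2 of the cubic less the 3/2 spent on the
        points of order two.\<close>
      then have "(1 / 2 - \<delta>) * height x \<le> ln (real_of_int (rad d)) + \<bar>C + D\<bar>"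
        unfolding left_diff_distrib using abs_ge_self[of "C + D"] by linarith
      then have "height x / 2 \<le> (1 + \<epsilon>) * (ln (real_of_int (rad d)) + \<bar>C + D\<bar>)"
        unfolding \<delta>(2) using \<epsilon> by (simp add: field_simps)
      then show ?thesis using M by (simp add: algebra_simps)
    qed
    then show ?thesis using le unfolding a_def d_def by linarith
  qed
  then show "\<exists>c. \<forall>P \<in> rational_points E - {Infinity}.
           max (1 / 2 * ln \<bar>real_of_int (point_a P)\<bar>) (ln \<bar>real_of_int (point_d P)\<bar>)
             \<le> (1 + \<epsilon>) * ln (real_of_int (rad (point_d P))) + c" by blast
qed

end
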